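(* Consider the algorithm $$X_{n+1}=X_n+a_n b_n(X_n,\xi_n)+a_n h(X_n,\zeta_n)+a_n h_0(\tilde\zeta_n)+a_n\beta_n,\qquad n\ge 0,$$ with values in $\mathbb R^d$. Assume that $\{X_n\}$ is bounded w.p.1 and that the following hold. (A-i) $h(\cdot,\zeta)$ is continuous in $x$, uniformly in $\zeta$, on bounded sets of $x$. (A-ii) Either $h$ is a bounded measurable function, or there are non-negative measurable functions $g_1$ (of $x$) and $g_2,g_3$ (of $\zeta$) such that $g_1$ is bounded on bounded sets, $|h(x,\zeta)|\le g_1(x)g_2(\zeta)+g_3(\zeta)$, and for each $\varepsilon>0$ $$\lim_{\Delta\to0}\lim_{n\to\infty}\mathbb P\Big\{\sup_{j\ge n}\max_{t\le\Delta}\sum_{i=m(j\Delta)}^{m(j\Delta+t)-1}a_i[g_2(\zeta_i)+g_3(\zeta_i)]\ge\varepsilon\Big\}=0.$$ (A-iii) There is a continuous function $\bar h:\mathbb R^d\to\mathbb R^d$ such that for some $T>0$, each $\varepsilon>0$ and each $x$, $$\lim_{n\to\infty}\mathbb P\Big\{\sup_{j\ge n}\max_{t\le T}\Big|\sum_{i=m(jT)}^{m(jT+t)-1}a_i\big(h(x,\zeta_i)-\bar h(x)\big)\Big|\ge\varepsilon\Big\}=0.$$ (A-iv) $\{\xi_n\},\{\zeta_n\},\{\tilde\zeta_n\}$ are independent of each other and are exogenous noises, and $h_0$ is measurable such that for some $T>0$ and each $\varepsilon>0$, $$\lim_{n\to\infty}\mathbb P\Big\{\sup_{j\ge n}\max_{t\le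 T}\Big|\sum_{i=m(jT)}^{m(jT+t)-1}a_ih_0(\tilde\zeta_i)\Big|\ge\varepsilon\Big\}=0.$$ (A-v) $\{\beta_n\}$ is a sequence of bounded random variables with $|\beta_n|\to0$ w.p.1. (K) There are a locally bounded function $\bar b:\mathbb R^d\to\mathbb R^d$ and a sequence of positive real-valued functions $m_n(x,\xi)$, continuous in $x$ uniformly in $\xi$, such that for all $n,x,\xi$, $$b_n(x,\xi)\in\mathcal K[\bar b](x)+m_n(x,\xi)\bar B,$$ and for some $T>0$, each $\varepsilon>0$ and each $x$, $$\lim_{n\to\infty}\mathbb P\Big\{\sup_{j\ge n}\max_{t\le T}\Big|\sum_{i=m(jT)}^{m(jT+t)-1}a_im_i(x,\xi_i)\Big|\ge\varepsilon\Big\}=0.$$ (KS) There is a unique $x^*\in\mathbb R^d$ with $\bar b(x^* )+\bar h(x^* )=0$, and there is a $C^\infty$-smooth pair of functions $(V,W)$ such that $V(x)>0$ and $W(x)>0$ for all $x\ne0$, $V(0)=0$, the sublevel sets $\{x\in\mathbb R^d:V(x)\le l\}$ are bounded for every $l\ge0$, and $$\limsup_{y\to x}\,\langle\nabla V(x),\bar b(y+x^* )+\bar h(y+x^* )\rangle\le-W(x)\qquad\text{for all }x\ne0.$$ Then there is a null set $\Omega_0$ such that for every $\omega\notin\Omega_0$, $X_n$ converges to $x^*$.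
   Context: All random variables live on a complete probability space $(\Omega,\mathcal F,\mathbb P)$; $|\cdot|$ is the Euclidean norm on $\mathbb R^d$; $\bar B$ is the closed unit ball of $\mathbb R^d$, $B(y,\delta)$ the open ball of center $y$ and radius $\delta$; $\overline{\mathrm{co}}$ is closed convex hull. For sets, $S+S_1=\{x+y:x\in S,y\in S_1\}$, $kS=\{kx:x\in S\}$. Step sizes: $a_n>0$, $a_n\to0$, $\sum_n a_n=\infty$. The noises $\xi_n,\zeta_n,\tilde\zeta_n$ take values in measurable spaces; $b_n(x,\xi)$, $h(x,\zeta)$, $h_0(\tilde\zeta)$ and $\beta_n$ are $\mathbb R^d$-valued. Exogenous means: the distribution of $\{\xi_i,i>n\}$ conditioned on $\{\xi_i,X_n:i\le n\}$ equals that conditioned on $\{\xi_i:i\le n\}$, and similarly for $\zeta_n$ and $\tilde\zeta_n$. $t_0=0$, $t_n=\sum_{i=0}^{n-1}a_i$; $m(t)=\max\{n:t_n\le t\}$ for $t\ge0$ and $m(t)=0$ for $t<0$. Krasovskii operator: $\mathcal K[f](y)=\bigcap_{\delta>0}\overline{\mathrm{co}}\,f(B(y,\delta))$.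
   Formalization: The functions m_n are assumed continuous in x uniformly in ξ and also in n, and the limsup over y→x in (KS) includes y=x; with a modulus of continuity depending on n, or with the limsup over y≠x only, the claim is false. *)

theory Defs
  imports "HOL-Probability.Probability"
begin

definition step_time :: "(nat \<Rightarrow> real) \<Rightarrow> nat \<Rightarrow> real" where
  "step_time a n = (\<Sum>i<n. a i)"

(* m(t) = max {n. t_n \<le> t} for t \<ge> 0, and m(t) = 0 for t < 0. The maximum is over a finite nonempty set when a is positive
   with divergent sum and t is nonnegative. *)
definition step_index :: "(nat \<Rightarrow> real) \<Rightarrow> real \<Rightarrow> nat" where
  "step_index a t = (if t < 0 then 0 else Max {n. step_time a n \<le> t})"

(* The half-open index range m(jT) \<le> i < m(jT+t) is the range from m(jT) to m(jT+t)-1,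
   without a truncated subtraction on nat. *)
definition window_sum ::
    "(nat \<Rightarrow> real) \<Rightarrow> real \<Rightarrow> (nat \<Rightarrow> 'w \<Rightarrow> 'v::real_vector) \<Rightarrow> nat \<Rightarrow> real \<Rightarrow> 'w \<Rightarrow> 'v" where
  "window_sum a T Y j t \<omega> =
     (\<Sum>i\<in>{step_index a (real j * T) ..< step_index a (real j * T + t)}. a i *\<^sub>R Y i \<omega>)"

(* The supremum over j may be infinite, so it is taken in ereal. For fixed j the inner supremum
   ranges over finitely many values, so that it is the maximum over 0 \<le> t \<le> T. *)
definition sup_event ::
    "'w measure \<Rightarrow> real \<Rightarrow> (nat \<Rightarrow> real \<Rightarrow> 'w \<Rightarrow> real) \<Rightarrow> real \<Rightarrow> nat \<Rightarrow> 'w set" where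
  "sup_event M T Q \<epsilon> n =
     {\<omega> \<in> space M. ereal \<epsilon> \<le> (SUP j\<in>{n..}. SUP t\<in>{0..T}. ereal (Q j t \<omega>))}"

(* The measure of a non-measurable set is 0 by convention, so that the sets whose probabilities
   are considered have to be required explicitly to be events. *)
definition rate_of_change_vanishes ::
    "'w measure \<Rightarrow> (nat \<Rightarrow> real) \<Rightarrow> real \<Rightarrow> (nat \<Rightarrow> 'w \<Rightarrow> 'v::real_normed_vector) \<Rightarrow> bool" where
  "rate_of_change_vanishes M a T Y \<longleftrightarrow>
     (\<forall>\<epsilon>>0.
        (\<forall>n. sup_event M T (\<lambda>j t \<omega>. norm (window_sum a T Y j t \<omega>)) \<epsilon> n \<in> sets M) \<and>
        (\<lambda>n. measure M (sup_event M T (\<lambda>j t \<omega>. norm (window_sum a T Y j t \<omega>)) \<epsilon> n))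
          \<longlonglongrightarrow> 0)"

definition continuous_on_unif ::
    "'a set \<Rightarrow> 'p set \<Rightarrow> ('a::metric_space \<Rightarrow> 'p \<Rightarrow> 'c::metric_space) \<Rightarrow> bool" where
  "continuous_on_unif S P f \<longleftrightarrow>
     (\<forall>x\<in>S. \<forall>\<epsilon>>0. \<exists>\<delta>>0. \<forall>y\<in>S. dist y x < \<delta> \<longrightarrow> (\<forall>p\<in>P. dist (f y p) (f x p) < \<epsilon>))"

(* The sigma-algebra on the sample space generated by the variables Z i with i in I. *)
definition noise_algebra ::
    "'w measure \<Rightarrow> 'b measure \<Rightarrow> nat set \<Rightarrow> (nat \<Rightarrow> 'w \<Rightarrow> 'b) \<Rightarrow> 'w measure" where
  "noise_algebra M N I Z =
     vimage_algebra (space M) (\<lambda>\<omega>. \<lambda>i\<in>I. Z i \<omega>) (PiM I (\<lambda>_. N))"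

(* The sigma-algebra generated by the variables Z i with i \<le> n and by X n. *)
definition noise_state_algebra ::
    "'w measure \<Rightarrow> 'b measure \<Rightarrow> (nat \<Rightarrow> 'w \<Rightarrow> 'b) \<Rightarrow> (nat \<Rightarrow> 'w \<Rightarrow> 'a::euclidean_space)
       \<Rightarrow> nat \<Rightarrow> 'w measure" where
  "noise_state_algebra M N Z X n =
     vimage_algebra (space M) (\<lambda>\<omega>. ((\<lambda>i\<in>{..n}. Z i \<omega>), X n \<omega>))
       (PiM {..n} (\<lambda>_. N) \<Otimes>\<^sub>M borel)"

(* Two conditional distributions of the future noise are equal when the conditional
   probabilities agree almost surely on each measurable set A of future noise sequences. *)
definition exogenous ::
    "'w measure \<Rightarrow> 'b measure \<Rightarrow> (nat \<Rightarrow> 'w \<Rightarrow> 'b) \<Rightarrow> (nat \<Rightarrow> 'w \<Rightarrow> 'a::euclidean_space) \<Rightarrow> bool" where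
  "exogenous M N Z X \<longleftrightarrow>
     (\<forall>n. \<forall>A\<in>sets (PiM {n<..} (\<lambda>_. N)). AE \<omega> in M.
        real_cond_exp M (noise_state_algebra M N Z X n)
          (\<lambda>\<omega>'. indicator A (\<lambda>i\<in>{n<..}. Z i \<omega>')) \<omega> =
        real_cond_exp M (noise_algebra M N {..n} Z)
          (\<lambda>\<omega>'. indicator A (\<lambda>i\<in>{n<..}. Z i \<omega>')) \<omega>)"

definition krasovskii :: "('a::euclidean_space \<Rightarrow> 'a) \<Rightarrow> 'a \<Rightarrow> 'a set" where
  "krasovskii f y = (\<Inter>\<delta>\<in>{0<..}. closure (convex hull (f ` ball y \<delta>)))"

definition locally_bounded :: "('a::metric_space \<Rightarrow> 'b::metric_space) \<Rightarrow> bool" where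
  "locally_bounded f \<longleftrightarrow> (\<forall>x. \<exists>\<delta>>0. bounded (f ` ball x \<delta>))"

definition gradient :: "('a::euclidean_space \<Rightarrow> real) \<Rightarrow> 'a \<Rightarrow> 'a" where
  "gradient f x = (THE D. GDERIV f x :> D)"

primrec C_k :: "nat \<Rightarrow> ('a::euclidean_space \<Rightarrow> real) \<Rightarrow> bool" where
  "C_k 0 f \<longleftrightarrow> continuous_on UNIV f"
| "C_k (Suc k) f \<longleftrightarrow>
     (\<forall>x. f differentiable (at x)) \<and> (\<forall>v. C_k k (\<lambda>x. frechet_derivative f (at x) v))"

definition C_infinity :: "('a::euclidean_space \<Rightarrow> real) \<Rightarrow> bool" where
  "C_infinity f \<longleftrightarrow> (\<forall>k. C_k k f)"

end

theory Submission
  imports Defs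
begin

text \<open>
  The argument is a Lyapunov argument carried out directly on the sequence \<open>X n\<close>, along one path at
  a time; no limiting differential inclusion is solved.

  Outside one null set, the weighted sums of the centred noise terms over windows of bounded time become
  arbitrarily small: \<open>AE_negligible_on_windows\<close> gives this for each fixed state \<open>x\<close>, and by
  equicontinuity a countable dense set of states is enough (\<open>negligible_on_windows_if_dense\<close>). On
  such a path the recursion reads
  \<open>X (Suc n) = X n + a n *\<^sub>R (v n + \<rho> n)\<close>. Here \<open>v n\<close> is the sum of a point of the Krasovskii
  set of \<open>bbar\<close> at \<open>X n\<close> and of \<open>hbar (X n)\<close>, while \<open>\<rho>\<close> averages out as long as the state stays
  near a fixed point (\<open>locally_negligible_trajectory\<close>).

  Let \<open>U\<close> be \<open>V\<close> recentred at \<open>xstar\<close>. Near a point \<open>x\<close> other than \<open>xstar\<close>, the upper limit in the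
  hypothesis on \<open>(V, W)\<close> confines the values of \<open>bbar\<close> to a half-space determined by the gradient
  of \<open>U\<close> at \<open>x\<close>. A closed half-space that contains the values also contains their closed convex
  hull, so the Krasovskii velocities obey the same inequality (\<open>velocity_inner_bound\<close>), and \<open>U\<close>
  decreases at a positive rate, up to arbitrarily small errors, while the sequence stays near \<open>x\<close>
  (\<open>local_descent\<close>). The sequence does stay near \<open>x\<close> for a time that is bounded from below
  (\<open>asymptotically_equicontinuous\<close>).

  Finally let \<open>l\<close> be a limit point of the bounded sequence at which \<open>U\<close> equals the upper limit of
  \<open>U (X n)\<close>. If \<open>l\<close> were not \<open>xstar\<close>, then a short time before each late visit near \<open>l\<close> the value
  of \<open>U\<close> would have exceeded this upper limit by a fixed amount, which is impossible
  (\<open>convergence_by_descent\<close>). So the upper limit is \<open>0\<close>, the minimum of \<open>U\<close>, and since the minimum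
  is attained only at \<open>xstar\<close>, the bounded sequence converges to \<open>xstar\<close>.
\<close>

section \<open>Step sizes and their time scale\<close>
locale step_sizes =
  fixes a :: "nat \<Rightarrow> real"
  assumes pos: "a n > 0"
    and tendsto_0: "a \<longlonglongrightarrow> 0"
    and diverges: "filterlim (\<lambda>n. \<Sum>i<n. a i) at_top sequentially"
begin

abbreviation t :: "nat \<Rightarrow> real" where "t \<equiv> step_time a"

lemma t_0: "t 0 = 0"
  by (simp add: step_time_def)

lemma t_Suc: "t (Suc n) = t n + a n"
  by (simp add: step_time_def)

lemma t_at_top: "filterlim t at_top sequentially"
  using diverges by (simp add: step_time_def[abs_def])

lemma strict_mono_t: "strict_mono t"
  by (rule strict_mono_Suc_iff[THEN iffD2]) (simp add: t_Suc pos)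

lemma t_mono: "n \<le> k \<Longrightarrow> t n \<le> t k"
  using strict_mono_t by (simp add: strict_mono_less_eq)

lemma t_nonneg: "0 \<le> t n"
  using t_mono[of 0 n] by (simp add: t_0)

lemma t_diff: "n \<le> k \<Longrightarrow> t k - t n = (\<Sum>i\<in>{n..<k}. a i)"
  by (induction k rule: dec_induct) (auto simp: t_Suc)

lemma finite_t_le: "finite {n. t n \<le> s}"
proof -
  have "eventually (\<lambda>n. s < t n) sequentially"
    using t_at_top by (simp add: filterlim_at_top_dense)
  then obtain N where N: "\<And>n. n \<ge> N \<Longrightarrow> s < t n"
    by (auto simp: eventually_sequentially)
  have "{n. t n \<le> s} \<subseteq> {..<N}"
    using N by (auto simp: not_less[symmetric])
  then show ?thesis
    by (rule finite_subset) simp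
qed

lemma step_index_t: "step_index a (t n) = n"
proof -
  have "{k. t k \<le> t n} = {..n}"
    using strict_mono_t by (auto simp: strict_mono_less_eq)
  then show ?thesis
    using t_nonneg[of n] by (simp add: step_index_def Max_eq_iff)
qed

lemma step_index_mono:
  assumes "0 \<le> s" "s \<le> s'"
  shows "step_index a s \<le> step_index a s'"
proof -
  have "0 \<in> {n. t n \<le> s}"
    using assms by (simp add: t_0)
  then have "Max {n. t n \<le> s} \<le> Max {n. t n \<le> s'}"
    using assms by (intro Max_mono) (auto simp: finite_t_le)
  then show ?thesis
    using assms by (simp add: step_index_def)
qed

text \<open>Because the steps tend to zero, the time scale has no large gaps: from a late index one can
  go back by an amount of time between \<open>\<tau> / 2\<close> and \<open>\<tau>\<close> and still end at a late index. Only
  the step leading out of the interval \<open>[t k - \<tau>, t k]\<close> is lost.\<close>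
lemma ex_index_before:
  assumes "\<tau> > 0"
  shows "\<forall>\<^sub>F k in sequentially. \<exists>n\<ge>N. n \<le> k \<and> \<tau> / 2 \<le> t k - t n \<and> t k - t n \<le> \<tau>"
proof -
  have "eventually (\<lambda>i. a i < \<tau> / 2) sequentially"
    using assms by (intro order_tendstoD(2)[OF tendsto_0]) simp
  then obtain N1 where N1: "\<And>i. i \<ge> N1 \<Longrightarrow> a i < \<tau> / 2"
    by (auto simp: eventually_sequentially)
  define N' where "N' = max N N1"
  have "eventually (\<lambda>k. t N' + \<tau> < t k) sequentially"
    using t_at_top by (simp add: filterlim_at_top_dense)
  then show ?thesis
  proof eventually_elim
    case (elim k)
    define n where "n = (LEAST n. t k - t n \<le> \<tau>)"
    have "t k - t k \<le> \<tau>"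
      using assms by simp
    then have n: "t k - t n \<le> \<tau>" "n \<le> k"
      unfolding n_def by (rule LeastI, rule Least_le)
    have "t N' < t n"
      using elim n by simp
    then have "N' < n"
      using strict_mono_t by (simp add: strict_mono_less)
    then obtain n' where n': "n = Suc n'" "N' \<le> n'"
      by (cases n) auto
    have "\<not> t k - t n' \<le> \<tau>"
      using not_less_Least[of n' "\<lambda>n. t k - t n \<le> \<tau>"] n' unfolding n_def by simp
    moreover have "a n' < \<tau> / 2"
      using n' by (intro N1) (simp add: N'_def)
    ultimately have "\<tau> / 2 \<le> t k - t n"
      by (simp add: n' t_Suc)
    then show ?case
      using n \<open>N' < n\<close> by (intro exI[of _ n]) (simp add: N'_def)
  qed
qed

section \<open>Weighted sums that are negligible over bounded time\<close>

text \<open>A pathwise form of vanishing rate of change. The windows start at an arbitrary late index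
  rather than at a multiple of \<open>T\<close>, so that they can follow the trajectory.\<close>
definition negligible_on_windows :: "real \<Rightarrow> (nat \<Rightarrow> 'v::real_normed_vector) \<Rightarrow> bool" where
  "negligible_on_windows T y \<longleftrightarrow>
     (\<forall>\<epsilon>>0. \<forall>\<^sub>F n in sequentially. \<forall>k\<ge>n. t k - t n \<le> T \<longrightarrow>
        norm (\<Sum>i\<in>{n..<k}. a i *\<^sub>R y i) \<le> \<epsilon>)"

lemma negligible_on_windows_antimono:
  assumes "negligible_on_windows T y" "T' \<le> T"
  shows "negligible_on_windows T' y"
  unfolding negligible_on_windows_def
proof (intro allI impI)
  fix \<epsilon> :: real assume "\<epsilon> > 0"
  with assms(1) have "\<forall>\<^sub>F n in sequentially. \<forall>k\<ge>n. t k - t n \<le> T \<longrightarrow>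
      norm (\<Sum>i\<in>{n..<k}. a i *\<^sub>R y i) \<le> \<epsilon>"
    unfolding negligible_on_windows_def by blast
  then show "\<forall>\<^sub>F n in sequentially. \<forall>k\<ge>n. t k - t n \<le> T' \<longrightarrow>
      norm (\<Sum>i\<in>{n..<k}. a i *\<^sub>R y i) \<le> \<epsilon>"
    by eventually_elim (use assms(2) in auto)
qed

lemma norm_weighted_sum_le:
  assumes "n \<le> k" and "\<And>i. i \<in> {n..<k} \<Longrightarrow> norm (y i) \<le> C"
  shows "norm (\<Sum>i\<in>{n..<k}. a i *\<^sub>R y i) \<le> C * (t k - t n)"
proof -
  have "norm (\<Sum>i\<in>{n..<k}. a i *\<^sub>R y i) \<le> (\<Sum>i\<in>{n..<k}. C * a i)"
    using assms(2) pos by (intro sum_norm_le) (auto simp: mult.commute mult_left_mono less_imp_le)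
  also have "\<dots> = C * (t k - t n)"
    using assms(1) by (simp add: t_diff sum_distrib_left)
  finally show ?thesis .
qed

lemma negligible_on_windows_if_tendsto_0:
  assumes "y \<longlonglongrightarrow> 0" "T > 0"
  shows "negligible_on_windows T y"
  unfolding negligible_on_windows_def
proof (intro allI impI)
  fix \<epsilon> :: real assume "\<epsilon> > 0"
  then have "eventually (\<lambda>i. norm (y i) < \<epsilon> / T) sequentially"
    using assms by (intro order_tendstoD(2)[OF tendsto_norm_zero[OF assms(1)]]) simp
  then obtain N where N: "\<And>i. i \<ge> N \<Longrightarrow> norm (y i) \<le> \<epsilon> / T"
    unfolding eventually_sequentially using less_imp_le by blast
  show "\<forall>\<^sub>F n in sequentially. \<forall>k\<ge>n. t k - t n \<le> T \<longrightarrow>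
      norm (\<Sum>i\<in>{n..<k}. a i *\<^sub>R y i) \<le> \<epsilon>"
    unfolding eventually_sequentially
  proof (intro exI allI impI)
    fix n k assume "N \<le> n" "n \<le> k" "t k - t n \<le> T"
    then have "norm (\<Sum>i\<in>{n..<k}. a i *\<^sub>R y i) \<le> \<epsilon> / T * (t k - t n)"
      by (intro norm_weighted_sum_le N) auto
    also have "\<dots> \<le> \<epsilon> / T * T"
      using \<open>t k - t n \<le> T\<close> \<open>\<epsilon> > 0\<close> assms(2) by (intro mult_left_mono) auto
    finally show "norm (\<Sum>i\<in>{n..<k}. a i *\<^sub>R y i) \<le> \<epsilon>"
      using assms(2) by simp
  qed
qed

text \<open>A window of length at most \<open>T\<close> meets at most two consecutive cells of the grid \<open>j T\<close>.
  Its sum is therefore a combination of at most three sums that start at a grid point and stay in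
  one cell.\<close>
lemma negligible_on_windows_if_grid:
  fixes Y :: "nat \<Rightarrow> 'w \<Rightarrow> 'v::real_normed_vector"
  assumes "T > 0"
    and grid: "\<And>\<epsilon>. \<epsilon> > 0 \<Longrightarrow> \<exists>J. \<forall>j\<ge>J. \<forall>s\<in>{0..T}. norm (window_sum a T Y j s \<omega>) < \<epsilon>"
  shows "negligible_on_windows T (\<lambda>i. Y i \<omega>)"
  unfolding negligible_on_windows_def
proof (intro allI impI)
  fix \<epsilon> :: real assume "\<epsilon> > 0"
  then have "\<epsilon> / 3 > 0"
    by simp
  from grid[OF this] obtain J
    where J: "\<And>j s. j \<ge> J \<Longrightarrow> s \<in> {0..T} \<Longrightarrow> norm (window_sum a T Y j s \<omega>) < \<epsilon> / 3"
    by blast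
  define S where "S n = (\<Sum>i<n. a i *\<^sub>R Y i \<omega>)" for n
  define \<mu> where "\<mu> j = step_index a (real j * T)" for j
  have S_diff: "(\<Sum>i\<in>{n..<k}. a i *\<^sub>R Y i \<omega>) = S k - S n" if "n \<le> k" for n k
    using that by (induction k rule: dec_induct) (auto simp: S_def)
  have cell: "\<exists>j. real j * T \<le> t n \<and> t n < real j * T + T" for n
  proof (intro exI conjI)
    let ?j = "nat \<lfloor>t n / T\<rfloor>"
    have j: "real ?j = of_int \<lfloor>t n / T\<rfloor>"
      using t_nonneg[of n] \<open>T > 0\<close> by simp
    show "real ?j * T \<le> t n"
      using of_int_floor_le[of "t n / T"] \<open>T > 0\<close>
      unfolding j by (simp only: pos_le_divide_eq)
    have "t n / T < real ?j + 1"
      unfolding j by linarith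
    then show "t n < real ?j * T + T"
      using \<open>T > 0\<close> by (simp only: pos_divide_less_eq distrib_right mult_1)
  qed
  have in_cell: "norm (S n - S (\<mu> j)) < \<epsilon> / 3"
    if "j \<ge> J" "real j * T \<le> t n" "t n \<le> real j * T + T" for j n
  proof -
    have "\<mu> j \<le> n"
      using step_index_mono[of "real j * T" "t n"] that \<open>T > 0\<close>
      by (simp add: \<mu>_def step_index_t)
    then have "window_sum a T Y j (t n - real j * T) \<omega> = S n - S (\<mu> j)"
      by (simp add: window_sum_def \<mu>_def step_index_t S_diff)
    then show ?thesis
      using J[of j "t n - real j * T"] that by simp
  qed
  have next_cell: "norm (S (\<mu> (Suc j)) - S (\<mu> j)) < \<epsilon> / 3" if "j \<ge> J" for j
  proof -
    have "\<mu> j \<le> \<mu> (Suc j)"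
      unfolding \<mu>_def using \<open>T > 0\<close> by (intro step_index_mono) (auto simp: algebra_simps)
    moreover have "step_index a (real j * T + T) = \<mu> (Suc j)"
      by (simp add: \<mu>_def algebra_simps)
    ultimately have "window_sum a T Y j T \<omega> = S (\<mu> (Suc j)) - S (\<mu> j)"
      by (simp add: window_sum_def \<mu>_def S_diff)
    then show ?thesis
      using J[of j T] that \<open>T > 0\<close> by simp
  qed
  have "eventually (\<lambda>n. (real J + 1) * T < t n) sequentially"
    using t_at_top by (simp add: filterlim_at_top_dense)
  then show "\<forall>\<^sub>F n in sequentially. \<forall>k\<ge>n. t k - t n \<le> T \<longrightarrow>
      norm (\<Sum>i\<in>{n..<k}. a i *\<^sub>R Y i \<omega>) \<le> \<epsilon>"
  proof eventually_elim
    case (elim n)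
    show ?case
    proof (intro allI impI)
      fix k assume "n \<le> k" "t k - t n \<le> T"
      obtain j where j: "real j * T \<le> t n" "t n < real j * T + T"
        using cell by blast
      have "(real J + 1) * T = real J * T + T"
        by (simp add: algebra_simps)
      with elim j have "real J * T < real j * T"
        by linarith
      then have "j \<ge> J"
        using \<open>T > 0\<close> by simp
      note n = in_cell[OF \<open>j \<ge> J\<close> j(1) less_imp_le[OF j(2)]]
      have "t n \<le> t k"
        using \<open>n \<le> k\<close> by (rule t_mono)
      have "norm (S k - S n) < \<epsilon>"
      proof (cases "t k \<le> real j * T + T")
        case True
        then have "norm (S k - S (\<mu> j)) < \<epsilon> / 3"
          using \<open>j \<ge> J\<close> j \<open>t n \<le> t k\<close> by (intro in_cell) auto
        then show ?thesis
          using n \<open>\<epsilon> > 0\<close> norm_triangle_ineq4[of "S k - S (\<mu> j)" "S n - S (\<mu> j)"] by simp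
      next
        case False
        then have "norm (S k - S (\<mu> (Suc j))) < \<epsilon> / 3"
          using \<open>j \<ge> J\<close> j \<open>t k - t n \<le> T\<close> by (intro in_cell) (auto simp: algebra_simps)
        moreover have eq: "S k - S n =
            (S k - S (\<mu> (Suc j))) + (S (\<mu> (Suc j)) - S (\<mu> j)) + (S (\<mu> j) - S n)"
          by simp
        ultimately show ?thesis
          unfolding eq using n next_cell[OF \<open>j \<ge> J\<close>]
            norm_triangle_ineq[of "S k - S (\<mu> (Suc j))" "S (\<mu> (Suc j)) - S (\<mu> j)"]
            norm_triangle_ineq[of "(S k - S (\<mu> (Suc j))) + (S (\<mu> (Suc j)) - S (\<mu> j))" "S (\<mu> j) - S n"]
            norm_minus_commute[of "S n" "S (\<mu> j)"]
          by linarith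
      qed
      then show "norm (\<Sum>i\<in>{n..<k}. a i *\<^sub>R Y i \<omega>) \<le> \<epsilon>"
        using \<open>n \<le> k\<close> by (simp add: S_diff)
    qed
  qed
qed

text \<open>The only passage from probability to paths. The exceptional events decrease with \<open>n\<close> and
  their probabilities tend to zero, so almost every \<open>\<omega>\<close> leaves them for some \<open>n\<close>; outside the
  \<open>n\<close>-th event, all windows from the \<open>n\<close>-th on are small.\<close>
lemma AE_negligible_on_windows:
  assumes "prob_space M" "T > 0" and rate: "rate_of_change_vanishes M a T Y"
  shows "AE \<omega> in M. negligible_on_windows T (\<lambda>i. Y i \<omega>)"
proof -
  interpret prob_space M by fact
  define E where "E \<epsilon> = sup_event M T (\<lambda>j s \<omega>. norm (window_sum a T Y j s \<omega>)) \<epsilon>" for \<epsilon>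
  have outside: "AE \<omega> in M. \<exists>n. \<omega> \<notin> E \<epsilon> n" if "\<epsilon> > 0" for \<epsilon>
  proof -
    have E: "\<And>n. E \<epsilon> n \<in> sets M" and lim: "(\<lambda>n. prob (E \<epsilon> n)) \<longlonglongrightarrow> 0"
      using rate that unfolding rate_of_change_vanishes_def E_def by auto
    have "prob (\<Inter>n. E \<epsilon> n) \<le> prob (E \<epsilon> n)" for n
      by (intro finite_measure_mono E) auto
    then have "prob (\<Inter>n. E \<epsilon> n) \<le> 0"
      using lim by (intro LIMSEQ_le_const) auto
    then have "(\<Inter>n. E \<epsilon> n) \<in> null_sets M"
      using E by (intro null_setsI) (auto simp: emeasure_eq_measure measure_le_0_iff)
    then show ?thesis
      by (rule AE_I') auto
  qed
  have "AE \<omega> in M. \<forall>p::nat. \<exists>n. \<omega> \<notin> E (inverse (real (Suc p))) n"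
    unfolding AE_all_countable by (intro allI outside) simp
  then show ?thesis
  proof (rule AE_mp, intro AE_I2 impI)
    fix \<omega> assume \<omega>: "\<omega> \<in> space M" and ev: "\<forall>p::nat. \<exists>n. \<omega> \<notin> E (inverse (real (Suc p))) n"
    show "negligible_on_windows T (\<lambda>i. Y i \<omega>)"
    proof (rule negligible_on_windows_if_grid[OF \<open>T > 0\<close>])
      fix \<epsilon> :: real assume "\<epsilon> > 0"
      then obtain p where p: "inverse (real (Suc p)) < \<epsilon>"
        using reals_Archimedean by blast
      let ?r = "inverse (real (Suc p))"
      obtain n where "\<omega> \<notin> E ?r n"
        using ev by blast
      then have less: "(SUP j\<in>{n..}. SUP s\<in>{0..T}. ereal (norm (window_sum a T Y j s \<omega>))) < ereal ?r"
        using \<omega> by (simp add: E_def sup_event_def not_le)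
      show "\<exists>J. \<forall>j\<ge>J. \<forall>s\<in>{0..T}. norm (window_sum a T Y j s \<omega>) < \<epsilon>"
      proof (intro exI allI impI ballI)
        fix j s assume "j \<ge> n" "s \<in> {0..T}"
        then have "ereal (norm (window_sum a T Y j s \<omega>))
            \<le> (SUP j\<in>{n..}. SUP s\<in>{0..T}. ereal (norm (window_sum a T Y j s \<omega>)))"
          by (intro SUP_upper2[where i = j] SUP_upper2[where i = s]) auto
        also note less
        finally show "norm (window_sum a T Y j s \<omega>) < \<epsilon>"
          using p by simp
      qed
    qed
  qed
qed

text \<open>Vanishing averages are known for each \<open>x\<close> up to a null set that depends on \<open>x\<close>.
  Equicontinuity lets a countable dense set of \<open>x\<close> suffice, so that one null set serves all
  of them: changing \<open>x\<close> by a little changes a window sum by at most \<open>T\<close> times the modulus of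
  continuity.\<close>
lemma negligible_on_windows_if_dense:
  fixes G :: "nat \<Rightarrow> 'b::metric_space \<Rightarrow> 'v::real_normed_vector"
  assumes "T > 0"
    and dense: "\<And>S. open S \<Longrightarrow> S \<noteq> {} \<Longrightarrow> \<exists>d\<in>D. d \<in> S"
    and equicont: "\<And>x \<epsilon>. \<epsilon> > 0 \<Longrightarrow> \<exists>\<delta>>0. \<forall>y. dist y x < \<delta> \<longrightarrow> (\<forall>i. dist (G i y) (G i x) < \<epsilon>)"
    and on_D: "\<And>d. d \<in> D \<Longrightarrow> negligible_on_windows T (\<lambda>i. G i d)"
  shows "negligible_on_windows T (\<lambda>i. G i x)"
  unfolding negligible_on_windows_def
proof (intro allI impI)
  fix \<epsilon> :: real assume "\<epsilon> > 0"
  then obtain \<delta> where "\<delta> > 0"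
    and \<delta>: "\<And>y i. dist y x < \<delta> \<Longrightarrow> dist (G i y) (G i x) < \<epsilon> / (2 * T)"
    using equicont[of "\<epsilon> / (2 * T)" x] \<open>T > 0\<close> by auto
  then obtain d where "d \<in> D" "d \<in> ball x \<delta>"
    using dense[of "ball x \<delta>"] by auto
  then have close: "norm (G i x - G i d) \<le> \<epsilon> / (2 * T)" for i
    using \<delta>[of d i] by (simp add: dist_commute dist_norm norm_minus_commute)
  have "\<forall>\<^sub>F n in sequentially. \<forall>k\<ge>n. t k - t n \<le> T \<longrightarrow>
      norm (\<Sum>i\<in>{n..<k}. a i *\<^sub>R G i d) \<le> \<epsilon> / 2"
    using on_D[OF \<open>d \<in> D\<close>] half_gt_zero[OF \<open>\<epsilon> > 0\<close>]
    unfolding negligible_on_windows_def by blast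
  then show "\<forall>\<^sub>F n in sequentially. \<forall>k\<ge>n. t k - t n \<le> T \<longrightarrow>
      norm (\<Sum>i\<in>{n..<k}. a i *\<^sub>R G i x) \<le> \<epsilon>"
  proof eventually_elim
    case (elim n)
    show ?case
    proof (intro allI impI)
      fix k assume k: "n \<le> k" "t k - t n \<le> T"
      have "norm (\<Sum>i\<in>{n..<k}. a i *\<^sub>R (G i x - G i d)) \<le> \<epsilon> / (2 * T) * (t k - t n)"
        using k close by (intro norm_weighted_sum_le)
      also have "\<dots> \<le> \<epsilon> / (2 * T) * T"
        using k \<open>\<epsilon> > 0\<close> \<open>T > 0\<close> by (intro mult_left_mono) auto
      also have "\<dots> = \<epsilon> / 2"
        using \<open>T > 0\<close> by simp
      finally have "norm (\<Sum>i\<in>{n..<k}. a i *\<^sub>R (G i x - G i d)) \<le> \<epsilon> / 2" .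
      moreover have "(\<Sum>i\<in>{n..<k}. a i *\<^sub>R G i x) =
          (\<Sum>i\<in>{n..<k}. a i *\<^sub>R (G i x - G i d)) + (\<Sum>i\<in>{n..<k}. a i *\<^sub>R G i d)"
        by (simp add: sum.distrib[symmetric] scaleR_add_right[symmetric])
      ultimately show "norm (\<Sum>i\<in>{n..<k}. a i *\<^sub>R G i x) \<le> \<epsilon>"
        using elim k norm_triangle_ineq[of "\<Sum>i\<in>{n..<k}. a i *\<^sub>R (G i x - G i d)"
            "\<Sum>i\<in>{n..<k}. a i *\<^sub>R G i d"] by fastforce
    qed
  qed
qed

section \<open>Perturbations that average out along a trajectory\<close>

text \<open>The two error terms play different roles. The part \<open>\<epsilon> * (t k - t n)\<close> is small compared
  with the elapsed time and comes from freezing the state at \<open>x\<close>; the part \<open>\<eta>\<close> comes from the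
  averaging of the noise and is as small as one likes at late indices, with the neighbourhood of
  \<open>x\<close> being fixed beforehand.\<close>
definition locally_negligible ::
    "real \<Rightarrow> (nat \<Rightarrow> 'b::metric_space) \<Rightarrow> (nat \<Rightarrow> 'v::real_normed_vector) \<Rightarrow> bool" where
  "locally_negligible T X \<rho> \<longleftrightarrow>
     (\<forall>x. \<forall>\<epsilon>>0. \<exists>\<delta>>0. \<forall>\<eta>>0. \<forall>\<^sub>F n in sequentially. \<forall>k\<ge>n. t k - t n \<le> T \<longrightarrow>
        (\<forall>i\<in>{n..<k}. dist (X i) x < \<delta>) \<longrightarrow>
        norm (\<Sum>i\<in>{n..<k}. a i *\<^sub>R \<rho> i) \<le> \<epsilon> * (t k - t n) + \<eta>)"

text \<open>While the trajectory stays near \<open>x\<close>, the value \<open>G i (X i)\<close> may be replaced by the frozen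
  value \<open>G i x\<close>, and averaging is assumed only for frozen values.\<close>
lemma locally_negligible_trajectory:
  fixes G :: "nat \<Rightarrow> 'b::metric_space \<Rightarrow> 'v::real_normed_vector"
  assumes equicont: "\<And>x \<epsilon>. \<epsilon> > 0 \<Longrightarrow> \<exists>\<delta>>0. \<forall>y. dist y x < \<delta> \<longrightarrow> (\<forall>i. dist (G i y) (G i x) < \<epsilon>)"
    and frozen: "\<And>x. negligible_on_windows T (\<lambda>i. G i x)"
  shows "locally_negligible T X (\<lambda>i. G i (X i))"
  unfolding locally_negligible_def
proof (intro allI impI)
  fix x and \<epsilon> :: real assume "\<epsilon> > 0"
  then obtain \<delta> where "\<delta> > 0" and \<delta>: "\<And>y i. dist y x < \<delta> \<Longrightarrow> dist (G i y) (G i x) < \<epsilon>"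
    using equicont by blast
  have "\<forall>\<^sub>F n in sequentially. \<forall>k\<ge>n. t k - t n \<le> T \<longrightarrow>
      (\<forall>i\<in>{n..<k}. dist (X i) x < \<delta>) \<longrightarrow>
      norm (\<Sum>i\<in>{n..<k}. a i *\<^sub>R G i (X i)) \<le> \<epsilon> * (t k - t n) + \<eta>" if "\<eta> > 0" for \<eta>
  proof -
    have "\<forall>\<^sub>F n in sequentially. \<forall>k\<ge>n. t k - t n \<le> T \<longrightarrow>
        norm (\<Sum>i\<in>{n..<k}. a i *\<^sub>R G i x) \<le> \<eta>"
      using frozen that unfolding negligible_on_windows_def by blast
    then show ?thesis
    proof eventually_elim
      case (elim n)
      show ?case
      proof (intro allI impI)
        fix k assume k: "n \<le> k" "t k - t n \<le> T" and near: "\<forall>i\<in>{n..<k}. dist (X i) x < \<delta>"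
        have "norm (\<Sum>i\<in>{n..<k}. a i *\<^sub>R (G i (X i) - G i x)) \<le> \<epsilon> * (t k - t n)"
          using k near \<delta> by (intro norm_weighted_sum_le) (auto simp: dist_norm less_imp_le)
        moreover have "(\<Sum>i\<in>{n..<k}. a i *\<^sub>R G i (X i)) =
            (\<Sum>i\<in>{n..<k}. a i *\<^sub>R (G i (X i) - G i x)) + (\<Sum>i\<in>{n..<k}. a i *\<^sub>R G i x)"
          by (simp add: sum.distrib[symmetric] scaleR_add_right[symmetric])
        ultimately show "norm (\<Sum>i\<in>{n..<k}. a i *\<^sub>R G i (X i)) \<le> \<epsilon> * (t k - t n) + \<eta>"
          using elim k norm_triangle_ineq[of "\<Sum>i\<in>{n..<k}. a i *\<^sub>R (G i (X i) - G i x)"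
              "\<Sum>i\<in>{n..<k}. a i *\<^sub>R G i x"] by fastforce
      qed
    qed
  qed
  then show "\<exists>\<delta>>0. \<forall>\<eta>>0. \<forall>\<^sub>F n in sequentially. \<forall>k\<ge>n. t k - t n \<le> T \<longrightarrow>
      (\<forall>i\<in>{n..<k}. dist (X i) x < \<delta>) \<longrightarrow>
      norm (\<Sum>i\<in>{n..<k}. a i *\<^sub>R G i (X i)) \<le> \<epsilon> * (t k - t n) + \<eta>"
    using \<open>\<delta> > 0\<close> by blast
qed

lemma locally_negligible_if_negligible:
  assumes "negligible_on_windows T \<rho>"
  shows "locally_negligible T X \<rho>"
  using locally_negligible_trajectory[of "\<lambda>i _. \<rho> i" T X] assms by (auto intro: exI[of _ 1])

lemma locally_negligible_add:
  assumes "locally_negligible T X \<rho>" "locally_negligible T X \<sigma>"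
  shows "locally_negligible T X (\<lambda>i. \<rho> i + \<sigma> i)"
  unfolding locally_negligible_def
proof (intro allI impI)
  fix x and \<epsilon> :: real assume "\<epsilon> > 0"
  then have "\<epsilon> / 2 > 0"
    by simp
  let ?P = "\<lambda>\<rho> \<delta> \<epsilon> \<eta> n. \<forall>k\<ge>n. t k - t n \<le> T \<longrightarrow> (\<forall>i\<in>{n..<k}. dist (X i) x < \<delta>) \<longrightarrow>
      norm (\<Sum>i\<in>{n..<k}. a i *\<^sub>R \<rho> i) \<le> \<epsilon> * (t k - t n) + \<eta>"
  obtain \<delta>1 where "\<delta>1 > 0" and \<delta>1: "\<And>\<eta>. \<eta> > 0 \<Longrightarrow> eventually (?P \<rho> \<delta>1 (\<epsilon> / 2) \<eta>) sequentially"
    using assms(1) \<open>\<epsilon> / 2 > 0\<close> unfolding locally_negligible_def by meson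
  obtain \<delta>2 where "\<delta>2 > 0" and \<delta>2: "\<And>\<eta>. \<eta> > 0 \<Longrightarrow> eventually (?P \<sigma> \<delta>2 (\<epsilon> / 2) \<eta>) sequentially"
    using assms(2) \<open>\<epsilon> / 2 > 0\<close> unfolding locally_negligible_def by meson
  have "eventually (?P (\<lambda>i. \<rho> i + \<sigma> i) (min \<delta>1 \<delta>2) \<epsilon> \<eta>) sequentially" if "\<eta> > 0" for \<eta>
  proof -
    from that have "\<eta> / 2 > 0" by simp
    from \<delta>1[OF this] \<delta>2[OF this] show ?thesis
    proof eventually_elim
      case (elim n)
      show ?case
      proof (intro allI impI)
        fix k assume k: "n \<le> k" "t k - t n \<le> T" and "\<forall>i\<in>{n..<k}. dist (X i) x < min \<delta>1 \<delta>2"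
        then have "norm (\<Sum>i\<in>{n..<k}. a i *\<^sub>R \<rho> i) \<le> \<epsilon> / 2 * (t k - t n) + \<eta> / 2"
          "norm (\<Sum>i\<in>{n..<k}. a i *\<^sub>R \<sigma> i) \<le> \<epsilon> / 2 * (t k - t n) + \<eta> / 2"
          using elim by auto
        then show "norm (\<Sum>i\<in>{n..<k}. a i *\<^sub>R (\<rho> i + \<sigma> i)) \<le> \<epsilon> * (t k - t n) + \<eta>"
          using norm_triangle_ineq[of "\<Sum>i\<in>{n..<k}. a i *\<^sub>R \<rho> i" "\<Sum>i\<in>{n..<k}. a i *\<^sub>R \<sigma> i"]
          by (simp add: scaleR_add_right sum.distrib)
      qed
    qed
  qed
  then show "\<exists>\<delta>>0. \<forall>\<eta>>0. eventually (?P (\<lambda>i. \<rho> i + \<sigma> i) \<delta> \<epsilon> \<eta>) sequentially"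
    using \<open>\<delta>1 > 0\<close> \<open>\<delta>2 > 0\<close> by (intro exI[of _ "min \<delta>1 \<delta>2"]) auto
qed

lemma locally_negligible_dominated:
  fixes \<sigma> :: "nat \<Rightarrow> real"
  assumes "locally_negligible T X \<sigma>" and "\<And>i. norm (\<rho> i) \<le> \<sigma> i"
  shows "locally_negligible T X \<rho>"
  unfolding locally_negligible_def
proof (intro allI impI)
  fix x and \<epsilon> :: real assume "\<epsilon> > 0"
  let ?P = "\<lambda>S \<delta> \<eta> n. \<forall>k\<ge>n. t k - t n \<le> T \<longrightarrow> (\<forall>i\<in>{n..<k}. dist (X i) x < \<delta>) \<longrightarrow>
      S n k \<le> \<epsilon> * (t k - t n) + \<eta>"
  obtain \<delta> where "\<delta> > 0"
    and \<delta>: "\<And>\<eta>. \<eta> > 0 \<Longrightarrow> eventually (?P (\<lambda>n k. norm (\<Sum>i\<in>{n..<k}. a i *\<^sub>R \<sigma> i)) \<delta> \<eta>) sequentially"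
    using assms(1) \<open>\<epsilon> > 0\<close> unfolding locally_negligible_def by meson
  have le: "norm (\<Sum>i\<in>{n..<k}. a i *\<^sub>R \<rho> i) \<le> norm (\<Sum>i\<in>{n..<k}. a i *\<^sub>R \<sigma> i)" for n k
  proof -
    have "norm (\<Sum>i\<in>{n..<k}. a i *\<^sub>R \<rho> i) \<le> (\<Sum>i\<in>{n..<k}. a i *\<^sub>R \<sigma> i)"
      using assms(2) pos by (intro sum_norm_le) (simp add: mult_left_mono less_imp_le)
    then show ?thesis
      by simp
  qed
  have "eventually (?P (\<lambda>n k. norm (\<Sum>i\<in>{n..<k}. a i *\<^sub>R \<rho> i)) \<delta> \<eta>) sequentially" if "\<eta> > 0" for \<eta>
    using \<delta>[OF that] by eventually_elim (use le order_trans in blast)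
  then show "\<exists>\<delta>>0. \<forall>\<eta>>0. eventually (?P (\<lambda>n k. norm (\<Sum>i\<in>{n..<k}. a i *\<^sub>R \<rho> i)) \<delta> \<eta>) sequentially"
    using \<open>\<delta> > 0\<close> by blast
qed

end

section \<open>Convergence of a perturbed recursion by descent\<close>

text \<open>Strict differentiability of a continuously differentiable function: the mean value
  inequality for \<open>y \<mapsto> U y - g x \<bullet> y\<close>, whose gradient is small near \<open>x\<close>.\<close>
lemma gradient_linearization:
  fixes U :: "'a::euclidean_space \<Rightarrow> real"
  assumes deriv: "\<And>x. (U has_derivative (\<lambda>h. g x \<bullet> h)) (at x)"
    and "isCont g x" and "\<epsilon> > 0"
  shows "\<exists>\<delta>>0. \<forall>y\<in>ball x \<delta>. \<forall>z\<in>ball x \<delta>. \<bar>U y - U z - g x \<bullet> (y - z)\<bar> \<le> \<epsilon> * norm (y - z)"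
proof -
  obtain \<delta> where "\<delta> > 0" and \<delta>: "\<And>y. dist y x < \<delta> \<Longrightarrow> dist (g y) (g x) < \<epsilon>"
    using \<open>isCont g x\<close> \<open>\<epsilon> > 0\<close> unfolding continuous_at_eps_delta by blast
  define f where "f y = U y - g x \<bullet> y" for y
  have "norm (f y - f z) \<le> \<epsilon> * norm (y - z)" if "y \<in> ball x \<delta>" "z \<in> ball x \<delta>" for y z
  proof (rule differentiable_bound[of "ball x \<delta>" f "\<lambda>y h. (g y - g x) \<bullet> h"])
    fix y assume y: "y \<in> ball x \<delta>"
    show "(f has_derivative (\<lambda>h. (g y - g x) \<bullet> h)) (at y within ball x \<delta>)"
      unfolding f_def inner_diff_left
      by (intro derivative_intros has_derivative_at_withinI[OF deriv])
    show "onorm (\<lambda>h. (g y - g x) \<bullet> h) \<le> \<epsilon>"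
    proof (rule onorm_le)
      fix h
      have "norm ((g y - g x) \<bullet> h) \<le> norm (g y - g x) * norm h"
        by (simp add: Cauchy_Schwarz_ineq2)
      also have "\<dots> \<le> \<epsilon> * norm h"
        using \<delta>[of y] y by (intro mult_right_mono) (auto simp: dist_norm norm_minus_commute)
      finally show "norm ((g y - g x) \<bullet> h) \<le> \<epsilon> * norm h" .
    qed
  qed (use that in auto)
  then have "\<forall>y\<in>ball x \<delta>. \<forall>z\<in>ball x \<delta>. \<bar>U y - U z - g x \<bullet> (y - z)\<bar> \<le> \<epsilon> * norm (y - z)"
    by (simp add: f_def inner_diff_right algebra_simps)
  with \<open>\<delta> > 0\<close> show ?thesis
    by blast
qed

text \<open>The sequence moves with velocity \<open>v\<close> up to a perturbation that averages out. The bound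
  on the velocity may depend on the region that is visited, as a locally bounded field provides.\<close>
locale perturbed_recursion = step_sizes +
  fixes X v \<rho> :: "nat \<Rightarrow> 'a::euclidean_space" and T :: real
  assumes T_pos: "T > 0"
    and step: "X (Suc n) = X n + a n *\<^sub>R (v n + \<rho> n)"
    and bounded: "bounded (range X)"
    and perturbation: "locally_negligible T X \<rho>"
    and velocity_bound: "\<exists>\<delta>>0. \<exists>B. \<forall>i. dist (X i) x < \<delta> \<longrightarrow> norm (v i) \<le> B"
begin

lemma increment:
  "n \<le> k \<Longrightarrow> X k - X n = (\<Sum>i\<in>{n..<k}. a i *\<^sub>R v i) + (\<Sum>i\<in>{n..<k}. a i *\<^sub>R \<rho> i)"
  by (induction k rule: dec_induct) (auto simp: step scaleR_add_right algebra_simps)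

text \<open>Near \<open>x\<close> the sequence has a finite speed up to small errors, so it cannot move far in a
  short time. Conversely, not having moved far is what keeps the local bounds valid; induction on
  the end of the window breaks this circle.\<close>
lemma asymptotically_equicontinuous_at:
  assumes "\<epsilon> > 0"
  shows "\<exists>r>0. \<exists>\<tau>>0. \<tau> \<le> T \<and>
    (\<forall>\<^sub>F n in sequentially. dist (X n) x < r \<longrightarrow>
       (\<forall>k\<ge>n. t k - t n \<le> \<tau> \<longrightarrow> dist (X k) (X n) < \<epsilon>))"
proof -
  obtain \<delta>1 B where "\<delta>1 > 0" and B: "\<And>i. dist (X i) x < \<delta>1 \<Longrightarrow> norm (v i) \<le> B"
    using velocity_bound by blast
  obtain \<delta>2 where "\<delta>2 > 0"
    and \<delta>2: "\<And>\<eta>. \<eta> > 0 \<Longrightarrow> \<forall>\<^sub>F n in sequentially. \<forall>k\<ge>n. t k - t n \<le> T \<longrightarrow>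
        (\<forall>i\<in>{n..<k}. dist (X i) x < \<delta>2) \<longrightarrow>
        norm (\<Sum>i\<in>{n..<k}. a i *\<^sub>R \<rho> i) \<le> 1 * (t k - t n) + \<eta>"
    using perturbation unfolding locally_negligible_def by (meson zero_less_one)
  define C where "C = max B 0 + 1"
  define r where "r = min \<delta>1 \<delta>2 / 2"
  define e where "e = min \<epsilon> r"
  define \<tau> where "\<tau> = min T (e / (2 * C))"
  have "C > 0"
    by (simp add: C_def)
  have "r > 0"
    using \<open>\<delta>1 > 0\<close> \<open>\<delta>2 > 0\<close> by (simp add: r_def)
  have "e > 0"
    using \<open>r > 0\<close> \<open>\<epsilon> > 0\<close> by (simp add: e_def)
  have "\<tau> > 0"
    using T_pos \<open>e > 0\<close> \<open>C > 0\<close> by (simp add: \<tau>_def)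
  have "\<tau> \<le> T"
    by (simp add: \<tau>_def)
  have "C * \<tau> \<le> C * (e / (2 * C))"
    using \<open>C > 0\<close> by (intro mult_left_mono) (auto simp: \<tau>_def)
  then have C\<tau>: "C * \<tau> \<le> e / 2"
    using \<open>C > 0\<close> by simp
  have "e / 4 > 0"
    using \<open>e > 0\<close> by simp
  have "\<forall>\<^sub>F n in sequentially. dist (X n) x < r \<longrightarrow>
      (\<forall>k\<ge>n. t k - t n \<le> \<tau> \<longrightarrow> dist (X k) (X n) < e)"
    using \<delta>2[OF \<open>e / 4 > 0\<close>]
  proof eventually_elim
    case (elim n)
    show ?case
    proof (intro impI allI)
      assume n: "dist (X n) x < r"
      \<comment> \<open>Before the time \<open>\<tau>\<close> has elapsed the sequence has no time to leave the ball in which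
        the bounds hold.\<close>
      show "dist (X k) (X n) < e" if "n \<le> k" "t k - t n \<le> \<tau>" for k
        using that
      proof (induction k rule: less_induct)
        case (less k)
        have "dist (X i) x < min \<delta>1 \<delta>2" if "i \<in> {n..<k}" for i
        proof -
          have "t i \<le> t k"
            using that by (intro t_mono) auto
          then have "dist (X i) (X n) < e"
            using that less.prems by (intro less.IH) auto
          then show ?thesis
            using n dist_triangle[of "X i" x "X n"] by (simp add: e_def r_def)
        qed
        then have near: "\<forall>i\<in>{n..<k}. dist (X i) x < \<delta>1" "\<forall>i\<in>{n..<k}. dist (X i) x < \<delta>2"
          by auto
        have "norm (\<Sum>i\<in>{n..<k}. a i *\<^sub>R \<rho> i) \<le> 1 * (t k - t n) + e / 4"
          using elim near(2) less.prems by (auto simp: \<tau>_def)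
        moreover have "norm (\<Sum>i\<in>{n..<k}. a i *\<^sub>R v i) \<le> max B 0 * (t k - t n)"
          using near(1) less.prems B by (intro norm_weighted_sum_le) fastforce+
        ultimately have "norm (X k - X n) \<le> C * (t k - t n) + e / 4"
          unfolding increment[OF \<open>n \<le> k\<close>] C_def
          by (intro norm_triangle_le) (simp add: algebra_simps)
        also have "\<dots> \<le> C * \<tau> + e / 4"
          using less.prems \<open>C > 0\<close> by simp
        also have "\<dots> < e"
          using C\<tau> \<open>e > 0\<close> by simp
        finally show ?case
          by (simp add: dist_norm)
      qed
    qed
  qed
  then have "\<forall>\<^sub>F n in sequentially. dist (X n) x < r \<longrightarrow>
      (\<forall>k\<ge>n. t k - t n \<le> \<tau> \<longrightarrow> dist (X k) (X n) < \<epsilon>)"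
    by eventually_elim (auto simp: e_def)
  then show ?thesis
    using \<open>r > 0\<close> \<open>\<tau> > 0\<close> \<open>\<tau> \<le> T\<close> by blast
qed

text \<open>The bounded range is covered by finitely many of the neighbourhoods from the local
  statement.\<close>
lemma asymptotically_equicontinuous:
  assumes "\<epsilon> > 0"
  shows "\<exists>\<tau>>0. \<tau> \<le> T \<and>
    (\<forall>\<^sub>F n in sequentially. \<forall>k\<ge>n. t k - t n \<le> \<tau> \<longrightarrow> dist (X k) (X n) < \<epsilon>)"
proof -
  define stable where "stable x r \<tau> \<longleftrightarrow> (\<forall>\<^sub>F n in sequentially. dist (X n) x < r \<longrightarrow>
       (\<forall>k\<ge>n. t k - t n \<le> \<tau> \<longrightarrow> dist (X k) (X n) < \<epsilon>))" for x r \<tau>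
  have "\<forall>x. \<exists>r \<tau>. r > 0 \<and> \<tau> > 0 \<and> \<tau> \<le> T \<and> stable x r \<tau>"
    using asymptotically_equicontinuous_at[OF assms] unfolding stable_def by blast
  then obtain r \<tau> where r: "\<And>x. r x > 0" and \<tau>: "\<And>x. \<tau> x > 0" "\<And>x. \<tau> x \<le> T"
    and stable: "\<And>x. stable x (r x) (\<tau> x)"
    by metis
  have compact: "compact (closure (range X))"
    using bounded by (simp only: compact_closure)
  have "closure (range X) \<subseteq> (\<Union>x\<in>UNIV. ball x (r x))"
    using r centre_in_ball by blast
  then obtain F where "F \<subseteq> UNIV" "finite F" and cover: "closure (range X) \<subseteq> (\<Union>x\<in>F. ball x (r x))"
    by (rule compactE_image[OF compact open_ball])
  have in_ball: "\<exists>x\<in>F. dist (X n) x < r x" for n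
    using cover closure_subset[of "range X"] by (force simp: dist_commute)
  then have "F \<noteq> {}"
    by blast
  define \<tau>0 where "\<tau>0 = Min (\<tau> ` F)"
  have le: "\<tau>0 \<le> \<tau> x" if "x \<in> F" for x
    using that \<open>finite F\<close> by (simp add: \<tau>0_def)
  have "\<tau>0 > 0"
    using \<tau>(1) \<open>finite F\<close> \<open>F \<noteq> {}\<close> by (simp add: \<tau>0_def)
  moreover have "\<tau>0 \<le> T"
    using \<open>F \<noteq> {}\<close> le \<tau>(2) order_trans by blast
  moreover have "\<forall>\<^sub>F n in sequentially. \<forall>x\<in>F. dist (X n) x < r x \<longrightarrow>
       (\<forall>k\<ge>n. t k - t n \<le> \<tau> x \<longrightarrow> dist (X k) (X n) < \<epsilon>)"
    using stable[unfolded stable_def] \<open>finite F\<close> by (intro eventually_ball_finite) blast+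
  then have "\<forall>\<^sub>F n in sequentially. \<forall>k\<ge>n. t k - t n \<le> \<tau>0 \<longrightarrow> dist (X k) (X n) < \<epsilon>"
  proof eventually_elim
    case (elim n)
    then show ?case
      using in_ball[of n] le by (meson order_trans)
  qed
  ultimately show ?thesis
    by blast
qed

text \<open>Near \<open>x\<close>, the increment of \<open>U\<close> is the inner product of the fixed vector \<open>g x\<close> with
  the increment of the sequence, up to \<open>\<epsilon>2\<close> times the length of the latter. Freezing the gradient
  makes the perturbation enter only through its weighted sum, which is small. The tolerances
  \<open>\<epsilon>1\<close> (perturbation) and \<open>\<epsilon>2\<close> (linearization) are chosen so that each costs at most a quarter
  of the decrease rate \<open>w\<close>.\<close>
lemma local_descent:
  fixes U :: "'a \<Rightarrow> real"
  assumes deriv: "\<And>x. (U has_derivative (\<lambda>h. g x \<bullet> h)) (at x)" and cont: "isCont g x"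
    and descent: "\<exists>\<delta>>0. \<exists>w>0. \<forall>i. dist (X i) x < \<delta> \<longrightarrow> g x \<bullet> v i \<le> - w"
  shows "\<exists>\<delta>>0. \<exists>c>0. \<forall>\<eta>>0. \<forall>\<^sub>F n in sequentially. \<forall>k\<ge>n. t k - t n \<le> T \<longrightarrow>
      (\<forall>i\<in>{n..k}. dist (X i) x < \<delta>) \<longrightarrow> U (X k) \<le> U (X n) - c * (t k - t n) + \<eta>"
proof -
  obtain \<delta>0 w where "\<delta>0 > 0" "w > 0" and w: "\<And>i. dist (X i) x < \<delta>0 \<Longrightarrow> g x \<bullet> v i \<le> - w"
    using descent by blast
  obtain \<delta>1 B' where "\<delta>1 > 0" and B': "\<And>i. dist (X i) x < \<delta>1 \<Longrightarrow> norm (v i) \<le> B'"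
    using velocity_bound by blast
  define B where "B = max B' 0"
  have "B \<ge> 0" and B: "\<And>i. dist (X i) x < \<delta>1 \<Longrightarrow> norm (v i) \<le> B"
    using B' by (auto simp: B_def le_max_iff_disj)
  define \<epsilon>2 where "\<epsilon>2 = w / (4 * (B + 1))"
  have "\<epsilon>2 > 0"
    using \<open>w > 0\<close> \<open>B \<ge> 0\<close> by (simp add: \<epsilon>2_def)
  obtain \<delta>2 where "\<delta>2 > 0"
    and \<delta>2: "\<And>y z. y \<in> ball x \<delta>2 \<Longrightarrow> z \<in> ball x \<delta>2 \<Longrightarrow>
        \<bar>U y - U z - g x \<bullet> (y - z)\<bar> \<le> \<epsilon>2 * norm (y - z)"
    using gradient_linearization[OF deriv cont \<open>\<epsilon>2 > 0\<close>] by blast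
  define G where "G = norm (g x)"
  have "G \<ge> 0"
    by (simp add: G_def)
  define \<epsilon>1 where "\<epsilon>1 = min 1 (w / (4 * (G + 1)))"
  have "\<epsilon>1 > 0"
    using \<open>w > 0\<close> \<open>G \<ge> 0\<close> by (simp add: \<epsilon>1_def)
  obtain \<delta>3 where "\<delta>3 > 0"
    and \<delta>3: "\<And>\<eta>. \<eta> > 0 \<Longrightarrow> \<forall>\<^sub>F n in sequentially. \<forall>k\<ge>n. t k - t n \<le> T \<longrightarrow>
        (\<forall>i\<in>{n..<k}. dist (X i) x < \<delta>3) \<longrightarrow>
        norm (\<Sum>i\<in>{n..<k}. a i *\<^sub>R \<rho> i) \<le> \<epsilon>1 * (t k - t n) + \<eta>"
    using perturbation \<open>\<epsilon>1 > 0\<close> unfolding locally_negligible_def by meson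
  have G\<epsilon>: "G * \<epsilon>1 \<le> w / 4"
  proof -
    have "G * \<epsilon>1 \<le> (G + 1) * (w / (4 * (G + 1)))"
      using \<open>G \<ge> 0\<close> \<open>\<epsilon>1 > 0\<close> by (intro mult_mono) (auto simp: \<epsilon>1_def)
    also have "\<dots> = w / 4"
      using \<open>G \<ge> 0\<close> by (simp add: field_simps)
    finally show ?thesis .
  qed
  have B\<epsilon>: "\<epsilon>2 * (\<epsilon>1 + B) \<le> w / 4"
  proof -
    have "\<epsilon>2 * (\<epsilon>1 + B) \<le> \<epsilon>2 * (B + 1)"
      using \<open>\<epsilon>2 > 0\<close> by (intro mult_left_mono) (auto simp: \<epsilon>1_def)
    also have "\<dots> = w / 4"
      using \<open>B \<ge> 0\<close> by (simp add: \<epsilon>2_def field_simps)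
    finally show ?thesis .
  qed
  define \<delta> where "\<delta> = min (min \<delta>0 \<delta>1) (min \<delta>2 \<delta>3)"
  have "\<forall>\<^sub>F n in sequentially. \<forall>k\<ge>n. t k - t n \<le> T \<longrightarrow>
      (\<forall>i\<in>{n..k}. dist (X i) x < \<delta>) \<longrightarrow> U (X k) \<le> U (X n) - w / 2 * (t k - t n) + \<eta>"
    if "\<eta> > 0" for \<eta>
  proof -
    define \<eta>' where "\<eta>' = \<eta> / (G + \<epsilon>2)"
    have \<eta>': "\<eta>' > 0" "(G + \<epsilon>2) * \<eta>' = \<eta>"
      using \<open>\<eta> > 0\<close> \<open>\<epsilon>2 > 0\<close> \<open>G \<ge> 0\<close> by (auto simp: \<eta>'_def)
    from \<delta>3[OF \<eta>'(1)] show ?thesis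
    proof eventually_elim
      case (elim n)
      show ?case
      proof (intro allI impI)
        fix k assume k: "n \<le> k" "t k - t n \<le> T" and near: "\<forall>i\<in>{n..k}. dist (X i) x < \<delta>"
        define s where "s = t k - t n"
        define R where "R = (\<Sum>i\<in>{n..<k}. a i *\<^sub>R \<rho> i)"
        define D where "D = (\<Sum>i\<in>{n..<k}. a i *\<^sub>R v i)"
        have "s \<ge> 0"
          using t_mono k by (simp add: s_def)
        have R: "norm R \<le> \<epsilon>1 * s + \<eta>'"
          using elim k near by (auto simp: R_def s_def \<delta>_def)
        have D: "norm D \<le> B * s"
          unfolding D_def s_def using k near B by (intro norm_weighted_sum_le) (auto simp: \<delta>_def)
        have gD: "g x \<bullet> D \<le> - w * s"
        proof -
          have "g x \<bullet> D = (\<Sum>i\<in>{n..<k}. a i * (g x \<bullet> v i))"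
            by (simp add: D_def inner_sum_right)
          also have "\<dots> \<le> (\<Sum>i\<in>{n..<k}. a i * (- w))"
            using near w pos by (intro sum_mono mult_left_mono) (auto simp: \<delta>_def less_imp_le)
          also have "\<dots> = - w * s"
            using k by (simp add: s_def t_diff sum_distrib_left sum_negf mult.commute)
          finally show ?thesis .
        qed
        have gR: "g x \<bullet> R \<le> G * norm R"
          using norm_cauchy_schwarz by (simp add: G_def)
        have inc: "X k - X n = D + R"
          using increment[OF k(1)] by (simp add: D_def R_def)
        have "U (X k) - U (X n) - g x \<bullet> (X k - X n) \<le> \<epsilon>2 * norm (X k - X n)"
          using \<delta>2[of "X k" "X n"] near k by (auto simp: \<delta>_def dist_commute)
        also have "\<dots> \<le> \<epsilon>2 * (norm D + norm R)"
          unfolding inc using \<open>\<epsilon>2 > 0\<close> by (intro mult_left_mono norm_triangle_ineq) auto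
        finally have "U (X k) - U (X n) \<le> - w * s + (G + \<epsilon>2) * norm R + \<epsilon>2 * norm D"
          using gD gR by (simp add: inc inner_add_right algebra_simps)
        also have "\<dots> \<le> - w * s + (G + \<epsilon>2) * (\<epsilon>1 * s + \<eta>') + \<epsilon>2 * (B * s)"
        proof -
          have "(G + \<epsilon>2) * norm R \<le> (G + \<epsilon>2) * (\<epsilon>1 * s + \<eta>')" "\<epsilon>2 * norm D \<le> \<epsilon>2 * (B * s)"
            using R D \<open>\<epsilon>2 > 0\<close> \<open>G \<ge> 0\<close> by (auto intro: mult_left_mono)
          then show ?thesis
            by linarith
        qed
        also have "\<dots> = - w * s + (G * \<epsilon>1 + \<epsilon>2 * (\<epsilon>1 + B)) * s + \<eta>"
          using \<eta>'(2) by (simp add: algebra_simps)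
        also have "\<dots> \<le> - w * s + (w / 4 + w / 4) * s + \<eta>"
          using mult_right_mono[OF add_mono[OF G\<epsilon> B\<epsilon>] \<open>s \<ge> 0\<close>] by linarith
        finally show "U (X k) \<le> U (X n) - w / 2 * (t k - t n) + \<eta>"
          by (simp add: s_def[symmetric] mult.commute)
      qed
    qed
  qed
  then show ?thesis
    using \<open>\<delta>0 > 0\<close> \<open>\<delta>1 > 0\<close> \<open>\<delta>2 > 0\<close> \<open>\<delta>3 > 0\<close> \<open>w > 0\<close>
    by (intro exI[of _ \<delta>] exI[of _ "w / 2"] conjI) (auto simp: \<delta>_def)
qed

text \<open>Among the limit points of the bounded sequence let \<open>l\<close> be one at which \<open>U\<close> takes the
  upper limit of \<open>U (X n)\<close>. If \<open>l\<close> were different from \<open>x0\<close>, consider a late index \<open>k\<close> with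
  \<open>X k\<close> near \<open>l\<close> and look back by a short time: by equicontinuity the sequence was near \<open>l\<close>
  throughout, so \<open>U\<close> has dropped by a fixed amount on the way to \<open>X k\<close>, and started from a
  value definitely above the upper limit. Hence the upper limit is the minimum \<open>U x0\<close>.\<close>
theorem convergence_by_descent:
  fixes U :: "'a \<Rightarrow> real"
  assumes deriv: "\<And>x. (U has_derivative (\<lambda>h. g x \<bullet> h)) (at x)" and cont: "\<And>x. isCont g x"
    and descent: "\<And>x. x \<noteq> x0 \<Longrightarrow> \<exists>\<delta>>0. \<exists>w>0. \<forall>i. dist (X i) x < \<delta> \<longrightarrow> g x \<bullet> v i \<le> - w"
    and minimum: "\<And>x. x \<noteq> x0 \<Longrightarrow> U x0 < U x"
  shows "X \<longlonglongrightarrow> x0"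
proof -
  have U_cont: "isCont U x" for x
    using deriv by (rule has_derivative_continuous)
  obtain r where "strict_mono r"
    and r: "((\<lambda>n. ereal (U (X n))) \<circ> r) \<longlonglongrightarrow> limsup (\<lambda>n. ereal (U (X n)))"
    using limsup_subseq_lim by blast
  have "bounded (range (X \<circ> r))"
    using bounded by (rule bounded_subset) auto
  then obtain l s where "strict_mono s" and s: "((X \<circ> r) \<circ> s) \<longlonglongrightarrow> l"
    using bounded_imp_convergent_subsequence by blast
  define q where "q = r \<circ> s"
  have "strict_mono q"
    using \<open>strict_mono r\<close> \<open>strict_mono s\<close> by (simp add: q_def strict_mono_o)
  have X_q: "(\<lambda>j. X (q j)) \<longlonglongrightarrow> l"
    using s by (simp add: q_def o_def)
  then have U_q: "(\<lambda>j. U (X (q j))) \<longlonglongrightarrow> U l"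
    by (rule isCont_tendsto_compose[OF U_cont])
  have "(\<lambda>j. ereal (U (X (q j)))) \<longlonglongrightarrow> limsup (\<lambda>n. ereal (U (X n)))"
    using LIMSEQ_subseq_LIMSEQ[OF r \<open>strict_mono s\<close>] by (simp add: q_def o_def)
  then have limsup: "limsup (\<lambda>n. ereal (U (X n))) = ereal (U l)"
    using U_q by (intro LIMSEQ_unique) auto
  have below: "\<forall>\<^sub>F n in sequentially. U (X n) < U l + \<eta>" if "\<eta> > 0" for \<eta>
    using Limsup_lessD[of sequentially "\<lambda>n. ereal (U (X n))" "ereal (U l + \<eta>)"] that
    by (simp add: limsup)
  have "l = x0"
  proof (rule ccontr)
    assume "l \<noteq> x0"
    obtain \<delta> c where "\<delta> > 0" "c > 0"
      and drop: "\<And>\<eta>. \<eta> > 0 \<Longrightarrow> \<forall>\<^sub>F n in sequentially. \<forall>k\<ge>n. t k - t n \<le> T \<longrightarrow>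
        (\<forall>i\<in>{n..k}. dist (X i) l < \<delta>) \<longrightarrow> U (X k) \<le> U (X n) - c * (t k - t n) + \<eta>"
      using local_descent[OF deriv cont descent[OF \<open>l \<noteq> x0\<close>]] by blast
    have "\<delta> / 3 > 0"
      using \<open>\<delta> > 0\<close> by simp
    then obtain \<tau> where "\<tau> > 0" "\<tau> \<le> T"
      and equi: "\<forall>\<^sub>F n in sequentially. \<forall>k\<ge>n. t k - t n \<le> \<tau> \<longrightarrow> dist (X k) (X n) < \<delta> / 3"
      using asymptotically_equicontinuous by blast
    \<comment> \<open>Over a time of at least \<open>\<tau> / 2\<close> the value drops by at least \<open>3 * \<eta>\<close>, up to an error \<open>\<eta>\<close>;
      it starts less than \<open>\<eta>\<close> above the upper limit and ends less than \<open>\<eta>\<close> below it.\<close>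
    define \<eta> where "\<eta> = c * \<tau> / 6"
    have "\<eta> > 0"
      using \<open>c > 0\<close> \<open>\<tau> > 0\<close> by (simp add: \<eta>_def)
    from drop[OF this] equi below[OF this]
    have "\<forall>\<^sub>F n in sequentially. U (X n) < U l + \<eta> \<and>
        (\<forall>k\<ge>n. t k - t n \<le> \<tau> \<longrightarrow> dist (X k) (X n) < \<delta> / 3) \<and>
        (\<forall>k\<ge>n. t k - t n \<le> T \<longrightarrow> (\<forall>i\<in>{n..k}. dist (X i) l < \<delta>) \<longrightarrow>
          U (X k) \<le> U (X n) - c * (t k - t n) + \<eta>)"
      by eventually_elim auto
    then obtain N where N: "\<And>n. n \<ge> N \<Longrightarrow> U (X n) < U l + \<eta>"
        "\<And>n k. n \<ge> N \<Longrightarrow> n \<le> k \<Longrightarrow> t k - t n \<le> \<tau> \<Longrightarrow> dist (X k) (X n) < \<delta> / 3"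
        "\<And>n k. n \<ge> N \<Longrightarrow> n \<le> k \<Longrightarrow> t k - t n \<le> T \<Longrightarrow> \<forall>i\<in>{n..k}. dist (X i) l < \<delta> \<Longrightarrow>
          U (X k) \<le> U (X n) - c * (t k - t n) + \<eta>"
      unfolding eventually_sequentially by blast
    have "\<forall>\<^sub>F j in sequentially. \<exists>n\<ge>N. n \<le> q j \<and> \<tau> / 2 \<le> t (q j) - t n \<and> t (q j) - t n \<le> \<tau>"
      using eventually_subseq[OF \<open>strict_mono q\<close> ex_index_before[OF \<open>\<tau> > 0\<close>]] .
    moreover have "\<forall>\<^sub>F j in sequentially. dist (X (q j)) l < \<delta> / 3"
      using X_q \<open>\<delta> / 3 > 0\<close> by (rule tendstoD)
    moreover have "\<forall>\<^sub>F j in sequentially. U l - \<eta> < U (X (q j))"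
      using \<open>\<eta> > 0\<close> by (intro order_tendstoD(1)[OF U_q]) simp
    ultimately have "\<forall>\<^sub>F j in sequentially. False"
    proof eventually_elim
      case (elim j)
      then obtain n where n: "n \<ge> N" "n \<le> q j" "\<tau> / 2 \<le> t (q j) - t n" "t (q j) - t n \<le> \<tau>"
        by blast
      have "dist (X i) l < \<delta>" if "i \<in> {n..q j}" for i
      proof -
        have "t i \<le> t (q j)"
          using that by (intro t_mono) simp
        then have "dist (X i) (X n) < \<delta> / 3"
          using that n by (intro N(2)) auto
        moreover have "dist (X (q j)) (X n) < \<delta> / 3"
          using n by (intro N(2)) auto
        ultimately show ?thesis
          using elim(2) dist_triangle[of "X i" l "X n"] dist_triangle3[of "X n" l "X (q j)"]
          by linarith
      qed
      then have "U (X (q j)) \<le> U (X n) - c * (t (q j) - t n) + \<eta>"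
        using n \<open>\<tau> \<le> T\<close> by (intro N(3)) auto
      moreover have "c * (\<tau> / 2) \<le> c * (t (q j) - t n)"
        using n \<open>c > 0\<close> by (intro mult_left_mono) auto
      ultimately show False
        using N(1)[OF n(1)] elim(3) by (simp add: \<eta>_def)
    qed
    then show False
      by simp
  qed
  show ?thesis
  proof (rule tendstoI)
    fix \<epsilon> :: real assume "\<epsilon> > 0"
    define S where "S = closure (range X) - ball x0 \<epsilon>"
    have "compact S"
      using bounded by (auto simp: S_def compact_eq_bounded_closed intro: bounded_diff)
    have "\<exists>\<eta>>0. \<forall>x\<in>S. U x0 + \<eta> \<le> U x"
    proof (cases "S = {}")
      case False
      have "continuous_on S U"
        using U_cont by (simp add: continuous_at_imp_continuous_on)
      then obtain z where "z \<in> S" "\<And>x. x \<in> S \<Longrightarrow> U z \<le> U x"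
        using continuous_attains_inf[OF \<open>compact S\<close> False] by blast
      moreover have "z \<noteq> x0"
        using \<open>z \<in> S\<close> \<open>\<epsilon> > 0\<close> by (auto simp: S_def)
      ultimately show ?thesis
        using minimum[of z] by (intro exI[of _ "U z - U x0"]) auto
    qed (auto intro: exI[of _ 1])
    then obtain \<eta> where "\<eta> > 0" and \<eta>: "\<And>x. x \<in> S \<Longrightarrow> U x0 + \<eta> \<le> U x"
      by blast
    from below[OF \<open>\<eta> > 0\<close>] show "\<forall>\<^sub>F n in sequentially. dist (X n) x0 < \<epsilon>"
      unfolding \<open>l = x0\<close>
    proof eventually_elim
      case (elim n)
      then have "X n \<notin> S"
        using \<eta>[of "X n"] by linarith
      then show ?case
        using closure_subset[of "range X"] by (auto simp: S_def dist_commute)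
    qed
  qed
qed

end

section \<open>Gradients and Krasovskii velocities\<close>
lemma krasovskii_subset:
  assumes "closed S" "convex S" "\<delta> > 0" "f ` ball y \<delta> \<subseteq> S"
  shows "krasovskii f y \<subseteq> S"
proof -
  have "krasovskii f y \<subseteq> closure (convex hull (f ` ball y \<delta>))"
    using \<open>\<delta> > 0\<close> by (auto simp: krasovskii_def)
  also have "\<dots> \<subseteq> S"
    using assms by (intro closure_minimal hull_minimal)
  finally show ?thesis .
qed

lemma has_derivative_frechet_coordinates:
  fixes f :: "'a::euclidean_space \<Rightarrow> real"
  assumes "f differentiable (at x)"
  shows "(f has_derivative
      (\<lambda>h. (\<Sum>b\<in>Basis. frechet_derivative f (at x) b *\<^sub>R b) \<bullet> h)) (at x)"
proof -
  let ?D = "frechet_derivative f (at x)"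
  have D: "(f has_derivative ?D) (at x)"
    using assms by (simp add: frechet_derivative_works)
  then have lin: "linear ?D"
    by (rule has_derivative_linear)
  have "?D h = (\<Sum>b\<in>Basis. ?D b *\<^sub>R b) \<bullet> h" for h
  proof -
    have "?D h = ?D (\<Sum>b\<in>Basis. (h \<bullet> b) *\<^sub>R b)"
      by (simp only: euclidean_representation)
    also have "\<dots> = (\<Sum>b\<in>Basis. (h \<bullet> b) * ?D b)"
      using lin by (simp add: linear_sum linear_scale)
    also have "\<dots> = (\<Sum>b\<in>Basis. ?D b *\<^sub>R b) \<bullet> h"
      by (subst inner_commute[of _ h]) (simp add: inner_sum_right mult.commute)
    finally show ?thesis .
  qed
  then have "?D = (\<lambda>h. (\<Sum>b\<in>Basis. ?D b *\<^sub>R b) \<bullet> h)"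
    by blast
  then show ?thesis
    by (rule has_derivative_eq_rhs[OF D])
qed

lemma gradient_eq:
  fixes f :: "'a::euclidean_space \<Rightarrow> real"
  assumes "(f has_derivative (\<lambda>h. D \<bullet> h)) (at x)"
  shows "gradient f x = D"
  unfolding gradient_def
proof (rule the_equality)
  show "GDERIV f x :> D"
    using assms by (simp add: gderiv_def inner_commute)
next
  fix D' assume "GDERIV f x :> D'"
  then have "(f has_derivative (\<lambda>h. D' \<bullet> h)) (at x)"
    by (simp add: gderiv_def inner_commute)
  then have "(\<lambda>h. D' \<bullet> h) = (\<lambda>h. D \<bullet> h)"
    using assms by (rule has_derivative_unique)
  then have "D' \<bullet> h = D \<bullet> h" for h
    by (rule fun_cong)
  then show "D' = D"
    by (rule vector_eq_rdot[THEN iffD1, OF allI])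
qed

lemma C_infinity_gradient:
  fixes f :: "'a::euclidean_space \<Rightarrow> real"
  assumes "C_infinity f"
  shows "(f has_derivative (\<lambda>h. gradient f x \<bullet> h)) (at x)" and "isCont (gradient f) x"
proof -
  have "C_k (Suc 0) f"
    using assms by (simp add: C_infinity_def del: C_k.simps)
  then have diff: "f differentiable (at x)"
    and cont: "continuous_on UNIV (\<lambda>x. frechet_derivative f (at x) v)" for x v
    by simp_all
  have grad: "gradient f = (\<lambda>x. \<Sum>b\<in>Basis. frechet_derivative f (at x) b *\<^sub>R b)"
    by (intro ext gradient_eq has_derivative_frechet_coordinates diff)
  show "(f has_derivative (\<lambda>h. gradient f x \<bullet> h)) (at x)"
    unfolding grad by (intro has_derivative_frechet_coordinates diff)
  have "continuous_on UNIV (gradient f)"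
    unfolding grad by (intro continuous_intros cont)
  then show "isCont (gradient f) x"
    by (simp add: continuous_on_eq_continuous_at)
qed

text \<open>The decrease condition bounds the values of \<open>f\<close> on a whole neighbourhood of \<open>x\<close>. Once the
  continuous part is frozen it says that these values lie in a closed half-space, and such a
  condition passes to closed convex hulls, hence to the Krasovskii operator.\<close>
lemma velocity_inner_bound:
  fixes f c :: "'a::euclidean_space \<Rightarrow> 'a"
  assumes decrease: "\<forall>\<^sub>F y in nhds x. g \<bullet> (f y + c y) \<le> - w"
    and "w > 0" and "isCont c x"
  shows "\<exists>\<delta>>0. \<forall>y. dist y x < \<delta> \<longrightarrow> (\<forall>u\<in>krasovskii f y. g \<bullet> (u + c y) \<le> - (w / 2))"
proof -
  have "isCont (\<lambda>y. g \<bullet> c y) x"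
    using \<open>isCont c x\<close> by (intro continuous_intros)
  then have "((\<lambda>y. g \<bullet> c y) \<longlongrightarrow> g \<bullet> c x) (nhds x)"
    by (intro tendsto_at_iff_tendsto_nhds[THEN iffD1] isContD)
  then have "\<forall>\<^sub>F y in nhds x. dist (g \<bullet> c y) (g \<bullet> c x) < w / 4"
    by (rule tendstoD) (use \<open>w > 0\<close> in simp)
  with decrease have "\<forall>\<^sub>F y in nhds x. g \<bullet> (f y + c y) \<le> - w \<and>
      dist (g \<bullet> c y) (g \<bullet> c x) < w / 4"
    by eventually_elim auto
  then obtain \<delta> where "\<delta> > 0"
    and \<delta>: "\<And>y. dist y x < \<delta> \<Longrightarrow> g \<bullet> (f y + c y) \<le> - w"
      "\<And>y. dist y x < \<delta> \<Longrightarrow> dist (g \<bullet> c y) (g \<bullet> c x) < w / 4"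
    unfolding eventually_nhds_metric by blast
  have "g \<bullet> (u + c y) \<le> - (w / 2)" if y: "dist y x < \<delta> / 2" and u: "u \<in> krasovskii f y" for y u
  proof -
    have "f ` ball y (\<delta> / 2) \<subseteq> {u. g \<bullet> u \<le> - (3 * w / 4) - g \<bullet> c x}"
    proof (intro image_subsetI CollectI)
      fix z assume "z \<in> ball y (\<delta> / 2)"
      then have "dist z x < \<delta>"
        using y dist_triangle[of z x y] by (simp add: dist_commute)
      then show "g \<bullet> f z \<le> - (3 * w / 4) - g \<bullet> c x"
        using \<delta>[of z] unfolding inner_add_right dist_real_def by linarith
    qed
    then have "krasovskii f y \<subseteq> {u. g \<bullet> u \<le> - (3 * w / 4) - g \<bullet> c x}"
      using \<open>\<delta> > 0\<close> by (intro krasovskii_subset closed_halfspace_le convex_halfspace_le) auto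
    then have "g \<bullet> u \<le> - (3 * w / 4) - g \<bullet> c x"
      using u by blast
    moreover have "dist y x < \<delta>"
      using y \<open>\<delta> > 0\<close> by simp
    ultimately show ?thesis
      using \<delta>(2)[of y] unfolding inner_add_right dist_real_def by linarith
  qed
  then show ?thesis
    using \<open>\<delta> > 0\<close> by (intro exI[of _ "\<delta> / 2"]) auto
qed

lemma velocity_norm_bound:
  fixes f c :: "'a::euclidean_space \<Rightarrow> 'a"
  assumes "locally_bounded f" and "isCont c x"
  shows "\<exists>\<delta>>0. \<exists>B. \<forall>y. dist y x < \<delta> \<longrightarrow> (\<forall>u\<in>krasovskii f y. norm (u + c y) \<le> B)"
proof -
  obtain \<delta>1 where "\<delta>1 > 0" and "bounded (f ` ball x \<delta>1)"
    using \<open>locally_bounded f\<close> unfolding locally_bounded_def by blast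
  then obtain B where B: "\<And>z. z \<in> ball x \<delta>1 \<Longrightarrow> norm (f z) \<le> B"
    unfolding bounded_iff by blast
  obtain \<delta>2 where "\<delta>2 > 0" and \<delta>2: "\<And>y. dist y x < \<delta>2 \<Longrightarrow> dist (c y) (c x) < 1"
    using \<open>isCont c x\<close> unfolding continuous_at_eps_delta by (meson zero_less_one)
  have "norm (u + c y) \<le> B + (norm (c x) + 1)"
    if y: "dist y x < min (\<delta>1 / 2) \<delta>2" and u: "u \<in> krasovskii f y" for y u
  proof -
    have "f ` ball y (\<delta>1 / 2) \<subseteq> cball 0 B"
    proof (intro image_subsetI)
      fix z assume "z \<in> ball y (\<delta>1 / 2)"
      then have "z \<in> ball x \<delta>1"
        using y dist_triangle[of x z y] by (simp add: dist_commute)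
      then show "f z \<in> cball 0 B"
        using B by simp
    qed
    then have "krasovskii f y \<subseteq> cball 0 B"
      using \<open>\<delta>1 > 0\<close> by (intro krasovskii_subset[of _ "\<delta>1 / 2"]) auto
    then have "norm u \<le> B"
      using u by auto
    moreover have "norm (c y) \<le> norm (c x) + 1"
      using \<delta>2[of y] y norm_triangle_sub[of "c y" "c x"] by (simp add: dist_norm)
    ultimately show ?thesis
      by (intro norm_triangle_le) simp
  qed
  then show ?thesis
    using \<open>\<delta>1 > 0\<close> \<open>\<delta>2 > 0\<close>
    by (intro exI[of _ "min (\<delta>1 / 2) \<delta>2"] exI[of _ "B + (norm (c x) + 1)"]) auto
qed

section \<open>The stochastic recursion\<close>

text \<open>The deterministic content of the result, for one path. The velocity consists of a selection
  \<open>u\<close> of the Krasovskii operator and of \<open>hbar\<close> at the current state; the distance of \<open>drift\<close> from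
  \<open>u\<close>, the deviation of \<open>H\<close> from its average and \<open>r\<close> make up the perturbation. The Lyapunov
  function is \<open>V\<close> recentred at \<open>xstar\<close>.\<close>
theorem (in step_sizes) krasovskii_recursion_converges:
  fixes X drift r :: "nat \<Rightarrow> 'a::euclidean_space" and H :: "nat \<Rightarrow> 'a \<Rightarrow> 'a" and \<mu> :: "nat \<Rightarrow> 'a \<Rightarrow> real"
  assumes "T > 0"
    and step: "\<And>n. X (Suc n) = X n + a n *\<^sub>R (drift n + H n (X n) + r n)"
    and bounded: "bounded (range X)"
    and incl: "\<And>n. \<exists>u\<in>krasovskii bbar (X n). norm (drift n - u) \<le> \<mu> n (X n)"
    and bbar: "locally_bounded bbar" and hbar: "\<And>x. isCont hbar x"
    and H_equicont: "\<And>x \<epsilon>. \<epsilon> > 0 \<Longrightarrow> \<exists>\<delta>>0. \<forall>y. dist y x < \<delta> \<longrightarrow> (\<forall>i. dist (H i y - hbar y) (H i x - hbar x) < \<epsilon>)"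
    and H_average: "\<And>x. negligible_on_windows T (\<lambda>i. H i x - hbar x)"
    and \<mu>_equicont: "\<And>x \<epsilon>. \<epsilon> > 0 \<Longrightarrow> \<exists>\<delta>>0. \<forall>y. dist y x < \<delta> \<longrightarrow> (\<forall>i. dist (\<mu> i y) (\<mu> i x) < \<epsilon>)"
    and \<mu>_average: "\<And>x. negligible_on_windows T (\<lambda>i. \<mu> i x)"
    and r_average: "locally_negligible T X r"
    and V: "C_infinity V" "\<And>x. x \<noteq> 0 \<Longrightarrow> V 0 < V x"
    and W: "\<And>x. x \<noteq> 0 \<Longrightarrow> W x > 0"
    and decrease: "\<And>x. x \<noteq> 0 \<Longrightarrow>
      Limsup (nhds x) (\<lambda>y. ereal (gradient V x \<bullet> (bbar (y + xstar) + hbar (y + xstar))))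
        \<le> ereal (- W x)"
  shows "X \<longlonglongrightarrow> xstar"
proof -
  have "\<forall>n. \<exists>u. u \<in> krasovskii bbar (X n) \<and> norm (drift n - u) \<le> \<mu> n (X n)"
    using incl by blast
  then obtain u where u: "\<And>n. u n \<in> krasovskii bbar (X n)"
    and u_close: "\<And>n. norm (drift n - u n) \<le> \<mu> n (X n)"
    by metis
  define v where "v n = u n + hbar (X n)" for n
  define \<rho> where "\<rho> n = (drift n - u n) + (H n (X n) - hbar (X n)) + r n" for n
  interpret perturbed_recursion a X v \<rho> T
  proof unfold_locales
    show "locally_negligible T X \<rho>"
      unfolding \<rho>_def
      by (intro locally_negligible_add r_average
            locally_negligible_dominated[OF locally_negligible_trajectory[OF \<mu>_equicont \<mu>_average] u_close]
            locally_negligible_trajectory[where G = "\<lambda>i x. H i x - hbar x"] H_equicont H_average)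
    show "\<exists>\<delta>>0. \<exists>B. \<forall>i. dist (X i) x < \<delta> \<longrightarrow> norm (v i) \<le> B" for x
      using velocity_norm_bound[OF bbar hbar, of x] u unfolding v_def by meson
    show "X (Suc n) = X n + a n *\<^sub>R (v n + \<rho> n)" for n
      by (simp add: step v_def \<rho>_def)
  qed (use \<open>T > 0\<close> bounded in auto)
  show ?thesis
  proof (rule convergence_by_descent)
    fix x
    have "((V \<circ> (\<lambda>x. x - xstar)) has_derivative ((\<lambda>h. gradient V (x - xstar) \<bullet> h) \<circ> (\<lambda>h. h))) (at x)"
      by (intro diff_chain_at C_infinity_gradient V) (auto intro!: derivative_eq_intros)
    then show "((\<lambda>x. V (x - xstar)) has_derivative (\<lambda>h. gradient V (x - xstar) \<bullet> h)) (at x)"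
      by (simp add: o_def)
    show "isCont (\<lambda>x. gradient V (x - xstar)) x"
      by (rule isCont_o2[OF _ C_infinity_gradient(2)[OF V(1)]]) (intro continuous_intros)
  next
    fix x assume "x \<noteq> xstar"
    then have nz: "x - xstar \<noteq> 0"
      by simp
    define w where "w = W (x - xstar) / 2"
    have "w > 0"
      using W[OF nz] by (simp add: w_def)
    have "Limsup (nhds (x - xstar))
        (\<lambda>y. ereal (gradient V (x - xstar) \<bullet> (bbar (y + xstar) + hbar (y + xstar)))) < ereal (- w)"
      by (rule le_less_trans[OF decrease[OF nz]]) (use \<open>w > 0\<close> in \<open>simp add: w_def\<close>)
    from Limsup_lessD[OF this]
    have "\<forall>\<^sub>F y in filtermap (\<lambda>y. y - - xstar) (nhds (x - xstar)).
        gradient V (x - xstar) \<bullet> (bbar y + hbar y) \<le> - w"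
      unfolding eventually_filtermap by eventually_elim simp
    then have "\<forall>\<^sub>F y in nhds x. gradient V (x - xstar) \<bullet> (bbar y + hbar y) \<le> - w"
      unfolding filtermap_nhds_shift by simp
    from velocity_inner_bound[OF this \<open>w > 0\<close> hbar] obtain \<delta> where "\<delta> > 0"
      and \<delta>: "\<And>y u. dist y x < \<delta> \<Longrightarrow> u \<in> krasovskii bbar y \<Longrightarrow>
        gradient V (x - xstar) \<bullet> (u + hbar y) \<le> - (w / 2)"
      by blast
    have "gradient V (x - xstar) \<bullet> v i \<le> - (w / 2)" if "dist (X i) x < \<delta>" for i
      unfolding v_def using that u by (rule \<delta>)
    then show "\<exists>\<delta>>0. \<exists>w>0. \<forall>i. dist (X i) x < \<delta> \<longrightarrow> gradient V (x - xstar) \<bullet> v i \<le> - w"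
      using \<open>\<delta> > 0\<close> half_gt_zero[OF \<open>w > 0\<close>] by blast
    show "V (xstar - xstar) < V (x - xstar)"
      using V(2)[OF nz] by simp
  qed
qed

theorem theorem2p3:
  fixes M :: "'w measure"
    and N\<xi> :: "'x measure" and N\<zeta> :: "'z measure" and N\<zeta>' :: "'y measure"
    and a :: "nat \<Rightarrow> real"
    and X :: "nat \<Rightarrow> 'w \<Rightarrow> 'a::euclidean_space"
    and \<xi> :: "nat \<Rightarrow> 'w \<Rightarrow> 'x" and \<zeta> :: "nat \<Rightarrow> 'w \<Rightarrow> 'z" and \<zeta>' :: "nat \<Rightarrow> 'w \<Rightarrow> 'y"
    and \<beta> :: "nat \<Rightarrow> 'w \<Rightarrow> 'a"
    and b :: "nat \<Rightarrow> 'a \<Rightarrow> 'x \<Rightarrow> 'a" and h :: "'a \<Rightarrow> 'z \<Rightarrow> 'a" and h0 :: "'y \<Rightarrow> 'a"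
    and m :: "nat \<Rightarrow> 'a \<Rightarrow> 'x \<Rightarrow> real"
    and bbar hbar :: "'a \<Rightarrow> 'a" and xstar :: 'a
    and V W :: "'a \<Rightarrow> real"
  assumes prob: "prob_space M" and compl: "complete_measure M"
    and a_pos: "\<And>n. a n > 0" and a_lim: "a \<longlonglongrightarrow> 0"
    and a_sum: "filterlim (\<lambda>n. \<Sum>i<n. a i) at_top sequentially"
    and \<xi>_rv: "\<And>n. \<xi> n \<in> measurable M N\<xi>"
    and \<zeta>_rv: "\<And>n. \<zeta> n \<in> measurable M N\<zeta>"
    and \<zeta>'_rv: "\<And>n. \<zeta>' n \<in> measurable M N\<zeta>'"
    and X_rv: "\<And>n. X n \<in> borel_measurable M"
    and \<beta>_rv: "\<And>n. \<beta> n \<in> borel_measurable M"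
    and algorithm: "\<And>n \<omega>. \<omega> \<in> space M \<Longrightarrow>
      X (Suc n) \<omega> = X n \<omega> + a n *\<^sub>R b n (X n \<omega>) (\<xi> n \<omega>) + a n *\<^sub>R h (X n \<omega>) (\<zeta> n \<omega>)
                    + a n *\<^sub>R h0 (\<zeta>' n \<omega>) + a n *\<^sub>R \<beta> n \<omega>"
    and X_bounded: "AE \<omega> in M. bounded (range (\<lambda>n. X n \<omega>))"
    and A_i: "\<And>S. bounded S \<Longrightarrow> continuous_on_unif S (space N\<zeta>) h"
    and A_ii:
      "((\<lambda>(x, z). h x z) \<in> borel_measurable (borel \<Otimes>\<^sub>M N\<zeta>) \<and>
          (\<exists>C. \<forall>x. \<forall>z\<in>space N\<zeta>. norm (h x z) \<le> C)) \<or>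
       (\<exists>g1 g2 g3.
          g1 \<in> borel_measurable borel \<and> g2 \<in> borel_measurable N\<zeta> \<and> g3 \<in> borel_measurable N\<zeta> \<and>
          (\<forall>x. 0 \<le> g1 x) \<and> (\<forall>z\<in>space N\<zeta>. 0 \<le> g2 z \<and> 0 \<le> g3 z) \<and>
          (\<forall>S. bounded S \<longrightarrow> bounded (g1 ` S)) \<and>
          (\<forall>x. \<forall>z\<in>space N\<zeta>. norm (h x z) \<le> g1 x * g2 z + g3 z) \<and>
          (\<forall>\<epsilon>>0. ((\<lambda>\<Delta>. lim (\<lambda>n. measure M
              (sup_event M \<Delta> (window_sum a \<Delta> (\<lambda>i \<omega>. g2 (\<zeta> i \<omega>) + g3 (\<zeta> i \<omega>) :: real)) \<epsilon> n)))
            \<longlongrightarrow> 0) (at_right 0)))"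
    and hbar_cont: "continuous_on UNIV hbar"
    and A_iii: "\<exists>T>0. \<forall>x. rate_of_change_vanishes M a T (\<lambda>i \<omega>. h x (\<zeta> i \<omega>) - hbar x)"
    and noise_indep:
      "prob_space.indep_sets M
         ((!) [sets (noise_algebra M N\<xi> UNIV \<xi>), sets (noise_algebra M N\<zeta> UNIV \<zeta>),
               sets (noise_algebra M N\<zeta>' UNIV \<zeta>')]) {..<3}"
    and noise_exogenous: "exogenous M N\<xi> \<xi> X" "exogenous M N\<zeta> \<zeta> X" "exogenous M N\<zeta>' \<zeta>' X"
    and h0_measurable: "h0 \<in> borel_measurable N\<zeta>'"
    and A_iv: "\<exists>T>0. rate_of_change_vanishes M a T (\<lambda>i \<omega>. h0 (\<zeta>' i \<omega>))"
    and A_v_bounded: "\<And>n. \<exists>C. AE \<omega> in M. norm (\<beta> n \<omega>) \<le> C"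
    and A_v_lim: "AE \<omega> in M. (\<lambda>n. norm (\<beta> n \<omega>)) \<longlonglongrightarrow> 0"
    and bbar_bounded: "locally_bounded bbar"
    and m_pos: "\<And>n x s. s \<in> space N\<xi> \<Longrightarrow> m n x s > 0"
    and m_cont: "continuous_on_unif UNIV (UNIV \<times> space N\<xi>) (\<lambda>x (n, s). m n x s)"
    and K_incl: "\<And>n x s. s \<in> space N\<xi> \<Longrightarrow>
      b n x s \<in> {u + v | u v. u \<in> krasovskii bbar x \<and> v \<in> (\<lambda>w. m n x s *\<^sub>R w) ` cball 0 1}"
    and K_rate: "\<exists>T>0. \<forall>x. rate_of_change_vanishes M a T (\<lambda>i \<omega>. m i x (\<xi> i \<omega>))"
    and xstar_zero: "bbar xstar + hbar xstar = 0"
    and xstar_unique: "\<And>y. bbar y + hbar y = 0 \<Longrightarrow> y = xstar"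
    and VW_smooth: "C_infinity V" "C_infinity W"
    and VW_pos: "\<And>x. x \<noteq> 0 \<Longrightarrow> V x > 0 \<and> W x > 0"
    and V_zero: "V 0 = 0"
    and V_sublevel: "\<And>l. l \<ge> 0 \<Longrightarrow> bounded {x. V x \<le> l}"
    and VW_decrease: "\<And>x. x \<noteq> 0 \<Longrightarrow>
      Limsup (nhds x) (\<lambda>y. ereal (gradient V x \<bullet> (bbar (y + xstar) + hbar (y + xstar))))
        \<le> ereal (- W x)"
  shows "\<exists>\<Omega>0 \<in> null_sets M. \<forall>\<omega> \<in> space M - \<Omega>0. (\<lambda>n. X n \<omega>) \<longlonglongrightarrow> xstar"
proof -
  interpret step_sizes a
    using a_pos a_lim a_sum by unfold_locales
  obtain T1 where "T1 > 0" and T1: "\<And>x. rate_of_change_vanishes M a T1 (\<lambda>i \<omega>. h x (\<zeta> i \<omega>) - hbar x)"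
    using A_iii by blast
  obtain T2 where "T2 > 0" and T2: "rate_of_change_vanishes M a T2 (\<lambda>i \<omega>. h0 (\<zeta>' i \<omega>))"
    using A_iv by blast
  obtain T3 where "T3 > 0" and T3: "\<And>x. rate_of_change_vanishes M a T3 (\<lambda>i \<omega>. m i x (\<xi> i \<omega>))"
    using K_rate by blast
  \<comment> \<open>The three averaging conditions may come with different window lengths; shorter windows are
    easier to control.\<close>
  define T where "T = min T1 (min T2 T3)"
  have "T > 0"
    using \<open>T1 > 0\<close> \<open>T2 > 0\<close> \<open>T3 > 0\<close> by (simp add: T_def)
  have AE_T: "AE \<omega> in M. negligible_on_windows T (\<lambda>i. Y i \<omega>)"
    if "rate_of_change_vanishes M a T' Y" "T' > 0" "T \<le> T'" for T' and Y :: "nat \<Rightarrow> 'w \<Rightarrow> 'v::real_normed_vector"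
    using AE_negligible_on_windows[OF prob that(2) that(1)]
    by (rule AE_mp) (use that(3) negligible_on_windows_antimono in auto)
  obtain D :: "'a set" where "countable D" and dense: "\<And>S. open S \<Longrightarrow> S \<noteq> {} \<Longrightarrow> \<exists>d\<in>D. d \<in> S"
    using countable_dense_setE by blast
  have h_AE: "AE \<omega> in M. \<forall>x\<in>D. negligible_on_windows T (\<lambda>i. h x (\<zeta> i \<omega>) - hbar x)"
    using \<open>countable D\<close> \<open>T1 > 0\<close> by (intro AE_ball_countable' AE_T[OF T1]) (auto simp: T_def)
  have m_AE: "AE \<omega> in M. \<forall>x\<in>D. negligible_on_windows T (\<lambda>i. m i x (\<xi> i \<omega>))"
    using \<open>countable D\<close> \<open>T3 > 0\<close> by (intro AE_ball_countable' AE_T[OF T3]) (auto simp: T_def)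
  have h0_AE: "AE \<omega> in M. negligible_on_windows T (\<lambda>i. h0 (\<zeta>' i \<omega>))"
    using \<open>T2 > 0\<close> by (intro AE_T[OF T2]) (auto simp: T_def)
  have hbar_isCont: "isCont hbar x" for x
    using hbar_cont by (simp add: continuous_on_eq_continuous_at)
  from h_AE m_AE h0_AE X_bounded A_v_lim AE_space have "AE \<omega> in M. (\<lambda>n. X n \<omega>) \<longlonglongrightarrow> xstar"
  proof eventually_elim
    case (elim \<omega>)
    have \<xi>: "\<xi> i \<omega> \<in> space N\<xi>" and \<zeta>: "\<zeta> i \<omega> \<in> space N\<zeta>" for i
      using elim(6) \<xi>_rv \<zeta>_rv by (auto intro: measurable_space)
    have h_equicont: "\<exists>\<delta>>0. \<forall>y. dist y x < \<delta> \<longrightarrow>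
        (\<forall>i. dist (h y (\<zeta> i \<omega>) - hbar y) (h x (\<zeta> i \<omega>) - hbar x) < \<epsilon>)" if \<epsilon>: "\<epsilon> > 0" for x \<epsilon>
    proof -
      have "x \<in> ball x 1"
        by simp
      then obtain \<delta>1 where "\<delta>1 > 0" and \<delta>1: "\<And>y p. y \<in> ball x 1 \<Longrightarrow> dist y x < \<delta>1 \<Longrightarrow>
          p \<in> space N\<zeta> \<Longrightarrow> dist (h y p) (h x p) < \<epsilon> / 2"
        using A_i[OF bounded_ball, of x 1] half_gt_zero[OF \<epsilon>] unfolding continuous_on_unif_def by meson
      obtain \<delta>2 where "\<delta>2 > 0" and \<delta>2: "\<And>y. dist y x < \<delta>2 \<Longrightarrow> dist (hbar y) (hbar x) < \<epsilon> / 2"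
        using hbar_isCont[of x] half_gt_zero[OF \<epsilon>] unfolding continuous_at_eps_delta by meson
      have "dist (h y (\<zeta> i \<omega>) - hbar y) (h x (\<zeta> i \<omega>) - hbar x) < \<epsilon>"
        if "dist y x < min 1 (min \<delta>1 \<delta>2)" for y i
      proof -
        have "y \<in> ball x 1"
          using that by (simp add: dist_commute)
        then have "dist (h y (\<zeta> i \<omega>)) (h x (\<zeta> i \<omega>)) < \<epsilon> / 2" "dist (hbar y) (hbar x) < \<epsilon> / 2"
          using that \<zeta> \<delta>1 \<delta>2 by simp_all
        then show ?thesis
          using norm_triangle_ineq4[of "h y (\<zeta> i \<omega>) - h x (\<zeta> i \<omega>)" "hbar y - hbar x"]
          by (simp add: dist_norm algebra_simps)
      qed
      then show ?thesis
        using \<open>\<delta>1 > 0\<close> \<open>\<delta>2 > 0\<close> by (intro exI[of _ "min 1 (min \<delta>1 \<delta>2)"]) auto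
    qed
    have m_equicont: "\<exists>\<delta>>0. \<forall>y. dist y x < \<delta> \<longrightarrow> (\<forall>i. dist (m i y (\<xi> i \<omega>)) (m i x (\<xi> i \<omega>)) < \<epsilon>)"
      if "\<epsilon> > 0" for x \<epsilon>
      using m_cont that \<xi> unfolding continuous_on_unif_def by fastforce
    have incl: "\<exists>u\<in>krasovskii bbar (X n \<omega>). norm (b n (X n \<omega>) (\<xi> n \<omega>) - u) \<le> m n (X n \<omega>) (\<xi> n \<omega>)" for n
    proof -
      obtain u w where "u \<in> krasovskii bbar (X n \<omega>)" "norm w \<le> 1"
        and "b n (X n \<omega>) (\<xi> n \<omega>) = u + m n (X n \<omega>) (\<xi> n \<omega>) *\<^sub>R w"
        using K_incl[OF \<xi>, of n "X n \<omega>" n] by auto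
      then show ?thesis
        using m_pos[OF \<xi>, of n "X n \<omega>" n] by (intro bexI[of _ u]) (auto intro: mult_left_le)
    qed
    have "(\<lambda>n. \<beta> n \<omega>) \<longlonglongrightarrow> 0"
      using elim(5) by (simp add: tendsto_norm_zero_iff)
    then have \<beta>: "negligible_on_windows T (\<lambda>i. \<beta> i \<omega>)"
      using \<open>T > 0\<close> by (rule negligible_on_windows_if_tendsto_0)
    show ?case
    proof (rule krasovskii_recursion_converges[where H = "\<lambda>i x. h x (\<zeta> i \<omega>)"
          and \<mu> = "\<lambda>i x. m i x (\<xi> i \<omega>)" and r = "\<lambda>i. h0 (\<zeta>' i \<omega>) + \<beta> i \<omega>"
          and drift = "\<lambda>n. b n (X n \<omega>) (\<xi> n \<omega>)" and V = V and W = W])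
      show "X (Suc n) \<omega> = X n \<omega> + a n *\<^sub>R
          (b n (X n \<omega>) (\<xi> n \<omega>) + h (X n \<omega>) (\<zeta> n \<omega>) + (h0 (\<zeta>' n \<omega>) + \<beta> n \<omega>))" for n
        using algorithm[OF elim(6)] by (simp add: scaleR_add_right)
      show "negligible_on_windows T (\<lambda>i. h x (\<zeta> i \<omega>) - hbar x)" for x
        by (rule negligible_on_windows_if_dense[OF \<open>T > 0\<close> dense,
              where G = "\<lambda>i x. h x (\<zeta> i \<omega>) - hbar x"]) (use elim(1) h_equicont in auto)
      show "negligible_on_windows T (\<lambda>i. m i x (\<xi> i \<omega>))" for x
        by (rule negligible_on_windows_if_dense[OF \<open>T > 0\<close> dense,
              where G = "\<lambda>i x. m i x (\<xi> i \<omega>)"]) (use elim(2) m_equicont in auto)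
      show "locally_negligible T (\<lambda>n. X n \<omega>) (\<lambda>i. h0 (\<zeta>' i \<omega>) + \<beta> i \<omega>)"
        using elim(3) \<beta> by (intro locally_negligible_add locally_negligible_if_negligible)
    qed (fact \<open>T > 0\<close> elim(4) incl bbar_bounded hbar_isCont h_equicont m_equicont VW_smooth VW_decrease
        | simp add: VW_pos V_zero)+
  qed
  then obtain N where "N \<in> null_sets M" "{\<omega> \<in> space M. \<not> (\<lambda>n. X n \<omega>) \<longlonglongrightarrow> xstar} \<subseteq> N"
    by (auto elim: AE_E3 simp: eventually_ae_filter)
  then show ?thesis
    by (intro bexI[of _ N]) auto
qed

end
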